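(* Let $(X,d)$ be a countable and proper metric space whose induced topology is discrete, $I=[0,1]$. Let $(\mu_t)_{t\in I}\in\mathcal{BV}(I:P_1(X))$ and assume that for each $t\in I$ the support $\mathrm{supp}(\mu_t)$ is bounded. Then there exists $(v_t)_{t\in I}$ so that $(\mu_t,v_t)$ satisfies the current equation. If further all measures $\mu_t$ are supported inside a common bounded set, then (i) for any $(v_t)$ such that the pair $(\mu_t,v_t)$ satisfies the current equation, we have $$|\dot\mu_t|\le\sum_{x,y}d(x,y)\,v_t^x(y)\,\mu_t(x),\quad\text{for }\mathcal L^1\text{-a.e. }t\in I;$$ (ii) there exists a $(v_t)$ satisfying the current equation (together with $(\mu_t)$) such that $$|\dot\mu_t|=\sum_{x,y}d(x,y)\,v_t^x(y)\,\mu_t(x),\quad\text{for }\mathcal L^1\text{-a.e. }t\in I.$$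
   Context: A metric space is proper if its closed bounded subsets are compact. $\mathcal L^1$ is Lebesgue measure. $P_1(X)$ is the set of Borel probability measures on $X$ with finite first moment, endowed with the $1$-Wasserstein distance $W_1$. $\mathcal M(X)$ is the set of positive measures on $X$. For a measure $\mu$ on $X$, write $\mu(x)=\mu(\{x\})$. Current equation: a family $(\mu_t,v_t)_{t\in I}$ with $\mu_t\in P(X)$ and $v_t:X\to\mathcal M(X)$, $x\mapsto v_t^x$, satisfies the current equation if for every $x\in X$ $$\frac{\mathrm d}{\mathrm dt}\mu_t(x)=\sum_{y\in X}v_t^y(x)\mu_t(y)-\mu_t(x)\sum_{y\in X}v_t^x(y),\quad\text{for }\mathcal L^1\text{-a.e. }t\in I.$$ $\mathcal{BV}(I:P_1(X))$ is the set of curves $(\mu_t)_{t\in I}$ in $(P_1(X),W_1)$ that are càdlàg (right-continuous with left limits with respect to $W_1$) and of bounded variation, i.e. with finite essential variation $\inf\{\mathrm{Var}(\nu;I):\nu_t=\mu_t\text{ for a.e. }t\}$, where $\mathrm{Var}(\nu;I)=\sup\sum_i W_1(\nu_{t_i},\nu_{t_{i+1}})$ over finite partitions $t_0<\dots<t_{k+1}$ in $I$. The metric derivative $|\dot\mu_t|=\lim_{h\to0}W_1(\mu_t,\mu_{t+h})/|h|$ exists for $\mathcal L^1$-a.e. $t$ for such curves. *)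

theory Defs
  imports "HOL-Probability.Probability"
begin

definition prob_measures :: "'a::metric_space measure set" where
  "prob_measures = {\<mu>. prob_space \<mu> \<and> sets \<mu> = sets borel}"

definition P1 :: "'a::metric_space measure set" where
  "P1 = {\<mu> \<in> prob_measures. \<exists>x0. integrable \<mu> (\<lambda>x. dist x0 x)}"

text \<open>No finiteness is imposed.\<close>

definition positive_measures :: "'a::metric_space measure set" where
  "positive_measures = {\<mu>. sets \<mu> = sets borel}"

definition supp :: "'a::metric_space measure \<Rightarrow> 'a set" where
  "supp \<mu> = {x. \<forall>U. open U \<longrightarrow> x \<in> U \<longrightarrow> emeasure \<mu> U > 0}"

definition couplings :: "'a::metric_space measure \<Rightarrow> 'a measure \<Rightarrow> ('a \<times> 'a) measure set" where
  "couplings \<mu> \<nu> = {\<pi>. prob_space \<pi> \<and> sets \<pi> = sets borel \<and>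
     distr \<pi> borel fst = \<mu> \<and> distr \<pi> borel snd = \<nu>}"

text \<open>Finite on \<^const>\<open>P1\<close>.\<close>

definition W1 :: "'a::metric_space measure \<Rightarrow> 'a measure \<Rightarrow> ennreal" where
  "W1 \<mu> \<nu> = (INF \<pi>\<in>couplings \<mu> \<nu>. \<integral>\<^sup>+ z. ennreal (dist (fst z) (snd z)) \<partial>\<pi>)"

text \<open>Curves are functions on all reals of which only the values on the interval \<open>I\<close> matter;
  hence limits and derivatives are taken within \<open>I\<close>.  At an endpoint of \<open>I\<close> the
  one-sided filter pointing out of \<open>I\<close> is trivial, so no condition arises there.\<close>

definition cadlag_on :: "real set \<Rightarrow> (real \<Rightarrow> 'a::metric_space measure) \<Rightarrow> bool" where
  "cadlag_on I \<mu> \<longleftrightarrow> (\<forall>t\<in>I.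
     ((\<lambda>s. W1 (\<mu> s) (\<mu> t)) \<longlongrightarrow> 0) (at t within I \<inter> {t<..}) \<and>
     (\<exists>\<nu>\<in>P1. ((\<lambda>s. W1 (\<mu> s) \<nu>) \<longlongrightarrow> 0) (at t within I \<inter> {..<t})))"

definition variation :: "real set \<Rightarrow> (real \<Rightarrow> 'a::metric_space measure) \<Rightarrow> ennreal" where
  "variation I \<nu> =
     (SUP (k, \<tau>) \<in> {(k::nat, \<tau>::nat \<Rightarrow> real). strict_mono_on {..k+1} \<tau> \<and> \<tau> ` {..k+1} \<subseteq> I}.
        \<Sum>i\<le>k. W1 (\<nu> (\<tau> i)) (\<nu> (\<tau> (i+1))))"

definition ess_variation :: "real set \<Rightarrow> (real \<Rightarrow> 'a::metric_space measure) \<Rightarrow> ennreal" where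
  "ess_variation I \<mu> =
     (INF \<nu> \<in> {\<nu>. (\<forall>t\<in>I. \<nu> t \<in> P1) \<and> (AE t\<in>I in lebesgue. \<nu> t = \<mu> t)}. variation I \<nu>)"

definition BV_curves :: "real set \<Rightarrow> (real \<Rightarrow> 'a::metric_space measure) set" where
  "BV_curves I = {\<mu>. (\<forall>t\<in>I. \<mu> t \<in> P1) \<and> cadlag_on I \<mu> \<and> ess_variation I \<mu> < \<infinity>}"

definition has_metric_derivative ::
  "(real \<Rightarrow> 'a::metric_space measure) \<Rightarrow> real \<Rightarrow> real set \<Rightarrow> real \<Rightarrow> bool" where
  "has_metric_derivative \<mu> m I t \<longleftrightarrow>
     ((\<lambda>h. enn2real (W1 (\<mu> t) (\<mu> (t + h))) / \<bar>h\<bar>) \<longlongrightarrow> m) (at 0 within {h. t + h \<in> I})"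

text \<open>The measure written $v_t^x$ in the mathematics is \<open>v t x\<close>.  Both sums are taken in
  $[0,\infty]$, with $0 \cdot \infty = 0$.\<close>

definition inflow ::
  "'a::metric_space measure \<Rightarrow> ('a \<Rightarrow> 'a measure) \<Rightarrow> 'a \<Rightarrow> ennreal" where
  "inflow \<mu> w x = (\<Sum>\<^sub>\<infinity>y. emeasure (w y) {x} * emeasure \<mu> {y})"

definition outflow ::
  "'a::metric_space measure \<Rightarrow> ('a \<Rightarrow> 'a measure) \<Rightarrow> 'a \<Rightarrow> ennreal" where
  "outflow \<mu> w x = emeasure \<mu> {x} * (\<Sum>\<^sub>\<infinity>y. emeasure (w x) {y})"

text \<open>The right-hand side of the equation is a real number only if both terms are finite; this is
  required explicitly because \<^const>\<open>enn2real\<close> sends \<open>\<infinity>\<close> to \<open>0\<close>.\<close>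

definition current_equation ::
  "real set \<Rightarrow> (real \<Rightarrow> 'a::metric_space measure) \<Rightarrow> (real \<Rightarrow> 'a \<Rightarrow> 'a measure) \<Rightarrow> bool" where
  "current_equation I \<mu> v \<longleftrightarrow>
     (\<forall>t\<in>I. \<mu> t \<in> prob_measures) \<and>
     (\<forall>t\<in>I. \<forall>x. v t x \<in> positive_measures) \<and>
     (\<forall>x. AE t\<in>I in lebesgue.
        inflow (\<mu> t) (v t) x < \<infinity> \<and> outflow (\<mu> t) (v t) x < \<infinity> \<and>
        ((\<lambda>s. measure (\<mu> s) {x}) has_real_derivative
           enn2real (inflow (\<mu> t) (v t) x) - enn2real (outflow (\<mu> t) (v t) x)) (at t within I))"

definition current_cost :: "'a::metric_space measure \<Rightarrow> ('a \<Rightarrow> 'a measure) \<Rightarrow> ennreal" where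
  "current_cost \<mu> w =
     (\<Sum>\<^sub>\<infinity>(x, y)\<in>UNIV. ennreal (dist x y) * emeasure (w x) {y} * emeasure \<mu> {x})"

end

theory Submission imports Defs begin

text \<open>Bounded sets are finite, and an atom of mass \<open>m\<close> that changes to \<open>m'\<close> costs at least
  \<open>r \<cdot> \<bar>m - m'\<bar>\<close> in \<open>W1\<close>, where \<open>r\<close> is the distance of the atom to the other points.  So the
  atoms of a BV curve are functions of bounded variation of time and, by Lebesgue's theorem,
  differentiable almost everywhere.  On a finite set \<open>W1\<close> depends only on the difference of the two
  measures: it is the least cost of a flow with that divergence (Beckmann's problem), which is a norm
  of the divergence.  Hence the metric derivative at \<open>t\<close> is the least cost of a flow whose divergence is
  the derivative of the atoms, and the currents satisfying the current equation at \<open>t\<close> are exactly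
  such flows, divided by the mass of the source point.\<close>

section \<open>Monotone functions are differentiable almost everywhere\<close>

text \<open>Dividing a flow by the mass of its source point fails where that mass is zero, and
  turning a flow into a coupling fails where more leaves a point than it holds. One property of
  minimisers removes both obstacles: an optimal flow with divergence \<open>g\<close> can be chosen
  to leave only points with \<open>g < 0\<close>, in total amount \<open>- g\<close>, and to enter
  only points with \<open>g > 0\<close>. It rests on the triangle inequality, since relayed mass may
  as well travel directly. At a massless point the derivative vanishes, so nothing leaves it.
  Conversely, an arbitrary current might push mass to points that no \<mu> charges. There the
  derivative is zero and nothing can flow out, so nothing flows in, and the current is a flow on the
  finite set after all. Finite essential variation controls only some representative \<nu> of the
  curve; right-continuity carries differentiability over to \<mu>. The common bounded set fixes one
  finite-dimensional space of divergences for all times, on which the minimal cost is continuous.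
  Existence of a current at a given time works with the finite support at that time alone.\<close>

lemma Vitali_covering_intervals:
  fixes S :: "real set"
  assumes "\<And>x d. x \<in> S \<Longrightarrow> 0 < d \<Longrightarrow> \<exists>u v. P u v \<and> u < v \<and> u \<le> x \<and> x \<le> v \<and> v - u < d"
  obtains C where "countable C" "\<And>i. i \<in> C \<Longrightarrow> P (fst i) (snd i) \<and> fst i < snd i"
    "disjoint_family_on (\<lambda>i. {fst i..snd i}) C"
    "negligible (S - (\<Union>i\<in>C. {fst i..snd i}))"
proof -
  define K where "K = {(u, v). u < v \<and> P u v}"
  define m where "m = (\<lambda>i::real \<times> real. (fst i + snd i) / 2)"
  define r where "r = (\<lambda>i::real \<times> real. (snd i - fst i) / 2)"
  have cb: "cball (m i) (r i) = {fst i..snd i}" for i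
    unfolding m_def r_def cball_eq_atLeastAtMost by (simp add: field_simps)
  have "\<exists>i. i \<in> K \<and> x \<in> cball (m i) (r i) \<and> r i < d" if x: "x \<in> S" "0 < d" for x d
  proof -
    obtain u v where uv: "P u v" "u < v" "u \<le> x" "x \<le> v" "v - u < d"
      using assms[OF x] by blast
    then have "(u, v) \<in> K" "x \<in> cball (m (u, v)) (r (u, v))" "r (u, v) < d"
      unfolding cb by (auto simp: K_def r_def)
    then show ?thesis by blast
  qed
  moreover have "0 < r i" if "i \<in> K" for i
    using that by (auto simp: K_def r_def)
  ultimately obtain C where C: "countable C" "C \<subseteq> K"
     "pairwise (\<lambda>i j. disjnt (cball (m i) (r i)) (cball (m j) (r j))) C"
     "negligible (S - (\<Union>i \<in> C. cball (m i) (r i)))"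
    using Vitali_covering_theorem_cballs[of K r S m] by blast
  show ?thesis
  proof (rule that[of C])
    show "disjoint_family_on (\<lambda>i. {fst i..snd i}) C"
      using C(3) unfolding cb disjoint_family_on_def pairwise_def disjnt_def by blast
  qed (use C in \<open>auto simp: cb K_def\<close>)
qed

text \<open>A monotone \<open>f\<close> sends disjoint intervals to non-overlapping intervals inside
  \<open>[f a, f b]\<close>, and the increments are the lengths of these images. The images are
  taken half-open because neighbouring ones may share an endpoint.\<close>

lemma nn_integral_disjoint_increments_le:
  fixes f :: "real \<Rightarrow> real"
  assumes mono: "mono_on {a..b} f" and "a \<le> b" and C: "countable C"
    and uv: "\<And>i. i \<in> C \<Longrightarrow> a \<le> u i \<and> u i < v i \<and> v i \<le> b"
    and disj: "disjoint_family_on (\<lambda>i. {u i..v i}) C"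
  shows "(\<integral>\<^sup>+i. ennreal (f (v i) - f (u i)) \<partial>count_space C) \<le> ennreal (f b - f a)"
proof -
  have le: "f x \<le> f y" if "a \<le> x" "x \<le> y" "y \<le> b" for x y
    using that by (intro mono_onD[OF mono]) auto
  have disj': "disjoint_family_on (\<lambda>i. {f (u i)..<f (v i)}) C"
    unfolding disjoint_family_on_def
  proof (intro ballI impI)
    fix i j assume ij: "i \<in> C" "j \<in> C" "i \<noteq> j"
    then have "{u i..v i} \<inter> {u j..v j} = {}"
      using disj by (auto simp: disjoint_family_on_def)
    then have "v i < u j \<or> v j < u i"
      using uv[OF ij(1)] uv[OF ij(2)]
      by (metis IntI atLeastAtMost_iff empty_iff less_eq_real_def linorder_not_less)
    then have "f (v i) \<le> f (u j) \<or> f (v j) \<le> f (u i)"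
      using uv[OF ij(1)] uv[OF ij(2)] le by fastforce
    then show "{f (u i)..<f (v i)} \<inter> {f (u j)..<f (v j)} = {}"
      by auto
  qed
  have "(\<integral>\<^sup>+i. ennreal (f (v i) - f (u i)) \<partial>count_space C)
      = (\<integral>\<^sup>+i. emeasure lborel {f (u i)..<f (v i)} \<partial>count_space C)"
    using uv by (intro nn_integral_cong) (auto simp: le less_imp_le)
  also have "\<dots> = emeasure lborel (\<Union>i\<in>C. {f (u i)..<f (v i)})"
    using C disj' by (intro emeasure_UN_countable[symmetric]) auto
  also have "\<dots> \<le> emeasure lborel {f a..f b}"
  proof (intro emeasure_mono)
    show "(\<Union>i\<in>C. {f (u i)..<f (v i)}) \<subseteq> {f a..f b}"
    proof clarify
      fix i y assume i: "i \<in> C" and y: "y \<in> {f (u i)..<f (v i)}"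
      then show "y \<in> {f a..f b}"
        using uv[OF i] le[of a "u i"] le[of "v i" b] by auto
    qed
  qed auto
  also have "\<dots> = ennreal (f b - f a)"
    using le \<open>a \<le> b\<close> by simp
  finally show ?thesis .
qed

text \<open>Short steep intervals form a Vitali cover of \<open>S\<close>. A countable disjoint
  subfamily covers almost all of \<open>S\<close>, the length of each member is at most its
  increment divided by \<open>p\<close>, and disjoint increments add up to at most
  \<open>f b - f a\<close>.\<close>

lemma emeasure_steep_le:
  fixes f :: "real \<Rightarrow> real"
  assumes mono: "mono_on {a..b} f" and "a \<le> b" and "0 < p"
    and S: "S \<in> sets lebesgue" "S \<subseteq> {a<..<b}"
    and steep: "\<And>x d. x \<in> S \<Longrightarrow> 0 < d \<Longrightarrow>
      \<exists>u v. u < v \<and> u \<le> x \<and> x \<le> v \<and> v - u < d \<and> p * (v - u) \<le> f v - f u"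
  shows "ennreal p * emeasure lebesgue S \<le> ennreal (f b - f a)"
proof -
  have cov: "\<exists>u v. (a \<le> u \<and> v \<le> b \<and> p * (v - u) \<le> f v - f u) \<and> u < v \<and> u \<le> x \<and> x \<le> v \<and> v - u < d"
    if "x \<in> S" "0 < d" for x d
  proof -
    \<comment> \<open>An interval around \<open>x\<close> shorter than the distance from
      \<open>x\<close> to either endpoint stays inside \<open>[a, b]\<close>, where \<open>f\<close>
      is known to be monotone.\<close>
    have "0 < min d (min (x - a) (b - x))" using that S by auto
    from steep[OF \<open>x \<in> S\<close> this] obtain u v where
      "u < v" "u \<le> x" "x \<le> v" "v - u < min d (min (x - a) (b - x))" "p * (v - u) \<le> f v - f u"
      by blast
    then show ?thesis by (intro exI[of _ u] exI[of _ v]) auto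
  qed
  obtain C where C: "countable C"
    "\<And>i. i \<in> C \<Longrightarrow> (a \<le> fst i \<and> snd i \<le> b \<and> p * (snd i - fst i) \<le> f (snd i) - f (fst i)) \<and> fst i < snd i"
    "disjoint_family_on (\<lambda>i. {fst i..snd i}) C" "negligible (S - (\<Union>i\<in>C. {fst i..snd i}))"
    using Vitali_covering_intervals[OF cov] by blast
  let ?U = "\<Union>i\<in>C. {fst i..snd i}"
  have U: "?U \<in> sets lebesgue" using C(1) by auto
  have "emeasure lebesgue S \<le> emeasure lebesgue (?U \<union> (S - ?U))"
    using S U by (intro emeasure_mono) auto
  also have "\<dots> = emeasure lebesgue ?U"
    using C(4) U by (intro emeasure_Un_null_set) (auto simp: negligible_iff_null_sets)
  also have "\<dots> = (\<integral>\<^sup>+i. emeasure lebesgue {fst i..snd i} \<partial>count_space C)"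
    using C by (intro emeasure_UN_countable) auto
  finally have "ennreal p * emeasure lebesgue S \<le> (\<integral>\<^sup>+i. ennreal p * emeasure lebesgue {fst i..snd i} \<partial>count_space C)"
    by (simp add: nn_integral_cmult mult_left_mono)
  also have "\<dots> \<le> (\<integral>\<^sup>+i. ennreal (f (snd i) - f (fst i)) \<partial>count_space C)"
    using C(2) \<open>0 < p\<close>
    by (intro nn_integral_mono) (simp add: less_imp_le ennreal_mult[symmetric] ennreal_leI)
  also have "\<dots> \<le> ennreal (f b - f a)"
    using C by (intro nn_integral_disjoint_increments_le[OF mono \<open>a \<le> b\<close>]) auto
  finally show ?thesis .
qed

text \<open>Disjoint flat intervals inside an open set slightly larger than \<open>S\<close> have
  total length at most the measure of \<open>S\<close> plus \<open>e\<close>. Within each, the steep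
  estimate bounds the part of \<open>S\<close> by the increment, hence by \<open>q\<close> times the
  length. So \<open>p * s \<le> q * (s + e)\<close> for the measure \<open>s\<close> of
  \<open>S\<close> and every \<open>e > 0\<close>, which forces \<open>s = 0\<close> as
  \<open>q < p\<close>.\<close>

lemma null_sets_steep_flat:
  fixes f :: "real \<Rightarrow> real"
  assumes mono: "mono_on {a..b} f" and "0 < q" "q < p"
    and S: "S \<in> sets lebesgue" "S \<subseteq> {a<..<b}"
    and steep: "\<And>x d. x \<in> S \<Longrightarrow> 0 < d \<Longrightarrow>
      \<exists>u v. u < x \<and> x < v \<and> v - u < d \<and> p * (v - u) \<le> f v - f u"
    and flat: "\<And>x d. x \<in> S \<Longrightarrow> 0 < d \<Longrightarrow>
      \<exists>u v. u < x \<and> x < v \<and> v - u < d \<and> f v - f u \<le> q * (v - u)"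
  shows "S \<in> null_sets lebesgue"
proof -
  have "emeasure lebesgue S \<le> emeasure lebesgue {a<..<b}"
    using S by (intro emeasure_mono) auto
  also have "\<dots> < \<infinity>" by (cases "a \<le> b") auto
  finally obtain s where s: "emeasure lebesgue S = ennreal s" "0 \<le> s"
    by (cases "emeasure lebesgue S") auto
  have key: "p * s \<le> q * (s + e)" if "0 < e" for e
  proof -
    obtain T where T: "open T" "S \<subseteq> T" "T - S \<in> lmeasurable" "emeasure lebesgue (T - S) < ennreal e"
      using sets_lebesgue_outer_open[OF S(1) \<open>0 < e\<close>] by blast
    have Tm: "T \<in> sets lebesgue" using T(1) by (simp add: borel_open)
    have "emeasure lebesgue T = emeasure lebesgue S + emeasure lebesgue (T - S)"
      using T S Tm by (subst plus_emeasure) (auto simp: Un_absorb1)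
    also have "\<dots> \<le> ennreal s + ennreal e" using T(4) s by (simp add: add_left_mono less_imp_le)
    finally have Te: "emeasure lebesgue T \<le> ennreal (s + e)" using s \<open>0 < e\<close> by simp
    have cov: "\<exists>u v. (a \<le> u \<and> v \<le> b \<and> {u..v} \<subseteq> T \<and> f v - f u \<le> q * (v - u)) \<and> u < v \<and> u \<le> x \<and> x \<le> v \<and> v - u < d"
      if "x \<in> S" "0 < d" for x d
    proof -
      obtain k where k: "0 < k" "cball x k \<subseteq> T"
        using T(1,2) \<open>x \<in> S\<close> by (meson open_contains_cball subsetD)
      have "0 < min (min d k) (min (x - a) (b - x))" using that S k by auto
      from flat[OF \<open>x \<in> S\<close> this] obtain u v where uv:
        "u < x" "x < v" "v - u < min (min d k) (min (x - a) (b - x))" "f v - f u \<le> q * (v - u)"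
        by blast
      have "{u..v} \<subseteq> cball x k" using uv by (auto simp: dist_real_def)
      then show ?thesis using uv k(2) by (intro exI[of _ u] exI[of _ v]) auto
    qed
    obtain C where C: "countable C"
      "\<And>i. i \<in> C \<Longrightarrow> (a \<le> fst i \<and> snd i \<le> b \<and> {fst i..snd i} \<subseteq> T \<and> f (snd i) - f (fst i) \<le> q * (snd i - fst i)) \<and> fst i < snd i"
      "disjoint_family_on (\<lambda>i. {fst i..snd i}) C" "negligible (S - (\<Union>i\<in>C. {fst i..snd i}))"
      using Vitali_covering_intervals[OF cov] by blast
    let ?U = "\<Union>i\<in>C. {fst i..snd i}"
    have each: "ennreal p * emeasure lebesgue (S \<inter> {fst i..snd i}) \<le> ennreal q * emeasure lebesgue {fst i..snd i}"
      if i: "i \<in> C" for i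
    proof -
      let ?u = "fst i" and ?v = "snd i"
      have i': "a \<le> ?u" "?v \<le> b" "f ?v - f ?u \<le> q * (?v - ?u)" "?u < ?v" using C(2)[OF i] by auto
      \<comment> \<open>The steep estimate applies to subsets of an open interval; the two endpoints
        form a null set.\<close>
      have "emeasure lebesgue (S \<inter> {?u..?v}) \<le> emeasure lebesgue (S \<inter> {?u<..<?v} \<union> {?u, ?v})"
        using S by (intro emeasure_mono sets.Un sets.Int) auto
      also have "\<dots> = emeasure lebesgue (S \<inter> {?u<..<?v})"
        using S by (intro emeasure_Un_null_set sets.Int) (auto simp: negligible_iff_null_sets[symmetric])
      finally have "ennreal p * emeasure lebesgue (S \<inter> {?u..?v}) \<le> ennreal p * emeasure lebesgue (S \<inter> {?u<..<?v})"
        by (rule mult_left_mono) simp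
      also have "\<dots> \<le> ennreal (f ?v - f ?u)"
      proof (rule emeasure_steep_le[where f = f and a = ?u and b = ?v and p = p])
        show "mono_on {?u..?v} f" using mono i' by (auto intro: mono_on_subset)
        show "\<exists>u v. u < v \<and> u \<le> x \<and> x \<le> v \<and> v - u < d \<and> p * (v - u) \<le> f v - f u"
          if "x \<in> S \<inter> {?u<..<?v}" "0 < d" for x d
          using steep[of x d] that by (metis IntD1 less_imp_le less_trans)
      qed (use S i' assms(2,3) in auto)
      also have "\<dots> \<le> ennreal q * emeasure lebesgue {?u..?v}"
        using i' \<open>0 < q\<close> by (simp add: less_imp_le ennreal_mult[symmetric] ennreal_leI)
      finally show ?thesis .
    qed
    have U: "?U \<in> sets lebesgue" using C(1) by auto
    have SU: "(\<Union>i\<in>C. S \<inter> {fst i..snd i}) \<in> sets lebesgue"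
      using C(1) S(1) by (intro sets.countable_UN') auto
    have "emeasure lebesgue S \<le> emeasure lebesgue ((\<Union>i\<in>C. S \<inter> {fst i..snd i}) \<union> (S - ?U))"
      by (intro emeasure_mono sets.Un SU sets.Diff U S(1)) auto
    also have "\<dots> = emeasure lebesgue (\<Union>i\<in>C. S \<inter> {fst i..snd i})"
      using C(4) SU by (intro emeasure_Un_null_set) (auto simp: negligible_iff_null_sets)
    also have "\<dots> = (\<integral>\<^sup>+i. emeasure lebesgue (S \<inter> {fst i..snd i}) \<partial>count_space C)"
    proof (intro emeasure_UN_countable C(1))
      show "disjoint_family_on (\<lambda>i. S \<inter> {fst i..snd i}) C"
        using C(3) unfolding disjoint_family_on_def by blast
    qed (use S in auto)
    finally have "ennreal p * emeasure lebesgue S \<le> (\<integral>\<^sup>+i. ennreal p * emeasure lebesgue (S \<inter> {fst i..snd i}) \<partial>count_space C)"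
      by (simp add: nn_integral_cmult mult_left_mono)
    also have "\<dots> \<le> (\<integral>\<^sup>+i. ennreal q * emeasure lebesgue {fst i..snd i} \<partial>count_space C)"
      using each by (intro nn_integral_mono) auto
    also have "\<dots> = ennreal q * emeasure lebesgue ?U"
      using C by (subst emeasure_UN_countable) (auto simp: nn_integral_cmult)
    also have "\<dots> \<le> ennreal q * emeasure lebesgue T"
      using C(2) Tm U by (intro mult_left_mono emeasure_mono) auto
    also have "\<dots> \<le> ennreal q * ennreal (s + e)"
      using Te by (intro mult_left_mono) auto
    finally have "ennreal (p * s) \<le> ennreal (q * (s + e))"
      using assms(2,3) s \<open>0 < e\<close> by (simp add: ennreal_mult)
    moreover have "0 \<le> q * (s + e)" using assms(2) s \<open>0 < e\<close> by simp
    ultimately show ?thesis by simp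
  qed
  have "p * s \<le> q * s"
  proof (rule field_le_epsilon)
    fix e :: real assume "0 < e"
    from key[of "e / q"] this \<open>0 < q\<close> show "p * s \<le> q * s + e" by (simp add: algebra_simps)
  qed
  then have "s \<le> 0" using \<open>q < p\<close> by (metis linorder_not_less mult_le_cancel_right)
  then show ?thesis using s S(1) by (auto simp: null_sets_def)
qed


text \<open>The hypothesis compares only values on opposite sides of \<open>x\<close>, never
  \<open>f x\<close> itself. To estimate \<open>f y - f x\<close>, the endpoint \<open>x\<close> is
  pushed across to \<open>x - h\<close> or \<open>x + h\<close>; monotonicity confines the resulting
  error to the increment over \<open>[x - h, x + h]\<close>, which is of order
  \<open>h\<close>.\<close>

lemma straddle_differentiable:
  fixes f :: "real \<Rightarrow> real"
  assumes mono: "mono_on {a..b} f" and x: "a < x" "x < b" and "0 \<le> L"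
    and str: "\<And>e. 0 < e \<Longrightarrow> \<exists>d>0. \<forall>u v. a \<le> u \<longrightarrow> v \<le> b \<longrightarrow> u < x \<longrightarrow> x < v \<longrightarrow> v - u < d \<longrightarrow>
      \<bar>f v - f u - L * (v - u)\<bar> \<le> e * (v - u)"
  shows "(f has_real_derivative L) (at x)"
proof -
  have le: "f y \<le> f z" if "a \<le> y" "y \<le> z" "z \<le> b" for y z
    using that by (intro mono_onD[OF mono]) auto
  have "\<exists>d>0. \<forall>y. \<bar>y - x\<bar> < d \<longrightarrow> \<bar>f y - f x - L * (y - x)\<bar> \<le> e * \<bar>y - x\<bar>" if "0 < e" for e
  proof -
    obtain d0 where d0: "0 < d0" and est: "\<And>u v. a \<le> u \<Longrightarrow> v \<le> b \<Longrightarrow> u < x \<Longrightarrow> x < v \<Longrightarrow> v - u < d0 \<Longrightarrow>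
      \<bar>f v - f u - L * (v - u)\<bar> \<le> e * (v - u)"
      using str[OF \<open>0 < e\<close>] by blast
    define d where "d = min (d0 / 2) (min (x - a) (b - x))"
    have d: "0 < d" "d \<le> d0 / 2" "d \<le> x - a" "d \<le> b - x"
      using d0 x unfolding d_def by linarith+
    have jump: "f (x + h) - f (x - h) \<le> 2 * (L + e) * h" if "0 < h" "h < d" for h
      using est[of "x - h" "x + h"] that d by (auto simp: abs_le_iff algebra_simps)
    have "\<bar>f y - f x - L * (y - x)\<bar> \<le> e * \<bar>y - x\<bar>" if y: "\<bar>y - x\<bar> < d" "y \<noteq> x" for y
    proof (rule field_le_epsilon)
      fix r :: real assume "0 < r"
      \<comment> \<open>Moving \<open>x\<close> by \<open>h\<close> causes three errors: at most
        \<open>2 * (L + e) * h\<close> from the increment, \<open>L * h\<close> from the linear term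
        and \<open>e * h\<close> from the longer interval. This \<open>h\<close> keeps their sum at
        most \<open>r\<close>.\<close>
      define h where "h = min (d / 2) (r / (3 * (L + e)))"
      have L: "0 < 3 * (L + e)" using \<open>0 \<le> L\<close> \<open>0 < e\<close> by simp
      have "h \<le> r / (3 * (L + e))" "h \<le> d / 2" unfolding h_def by (rule min.cobounded2, rule min.cobounded1)
      moreover have "0 < h" unfolding h_def using d(1) divide_pos_pos[OF \<open>0 < r\<close> L] by simp
      ultimately have h: "0 < h" "h < d" "h * (3 * (L + e)) \<le> r"
        using d(1) by (simp_all only: pos_le_divide_eq[OF L])
      have inc: "f (x - h) \<le> f x" "f x \<le> f (x + h)"
        using h d by (auto intro!: le)
      have Lh: "0 \<le> L * h" using \<open>0 \<le> L\<close> h by simp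
      note J = jump[OF h(1,2)]
      consider "x < y" | "y < x" using y by linarith
      then have "\<bar>f y - f x - L * (y - x)\<bar> \<le> e * \<bar>y - x\<bar> + h * (3 * (L + e))"
      proof cases
        case 1
        have "\<bar>f y - f (x - h) - L * (y - (x - h))\<bar> \<le> e * (y - (x - h))"
          using 1 y h d by (intro est) auto
        moreover have "\<bar>f y - f x - L * (y - x)\<bar>
            \<le> \<bar>f y - f (x - h) - L * (y - (x - h))\<bar> + (f x - f (x - h)) + L * h"
        proof -
          have "f y - f x - L * (y - x) = f y - f (x - h) - L * (y - (x - h)) - (f x - f (x - h)) + L * h"
            by (simp add: algebra_simps)
          then show ?thesis using inc Lh by linarith
        qed
        moreover have "\<bar>y - x\<bar> = y - x" using 1 by simp
        ultimately show ?thesis using J inc by (simp add: algebra_simps)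
      next
        case 2
        have "\<bar>f (x + h) - f y - L * (x + h - y)\<bar> \<le> e * (x + h - y)"
          using 2 y h d by (intro est) auto
        moreover have "\<bar>f y - f x - L * (y - x)\<bar>
            \<le> \<bar>f (x + h) - f y - L * (x + h - y)\<bar> + (f (x + h) - f x) + L * h"
        proof -
          have "f y - f x - L * (y - x) = - (f (x + h) - f y - L * (x + h - y)) + (f (x + h) - f x) - L * h"
            by (simp add: algebra_simps)
          then show ?thesis using inc Lh by linarith
        qed
        moreover have "\<bar>y - x\<bar> = x - y" using 2 by simp
        ultimately show ?thesis using J inc by (simp add: algebra_simps)
      qed
      then show "\<bar>f y - f x - L * (y - x)\<bar> \<le> e * \<bar>y - x\<bar> + r" using h(3) by linarith
    qed
    then have "\<forall>y. \<bar>y - x\<bar> < d \<longrightarrow> \<bar>f y - f x - L * (y - x)\<bar> \<le> e * \<bar>y - x\<bar>"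
      by (metis abs_zero diff_self mult_zero_right order_refl)
    then show ?thesis using d(1) by blast
  qed
  then show ?thesis
    unfolding has_field_derivative_def has_derivative_within_alt
    by (auto simp: bounded_linear_mult_right)
qed

text \<open>Lebesgue's theorem, by way of slopes over intervals straddling the point. If these
  slopes stay bounded and do not oscillate at small scales, the infimum of their eventual rational
  upper bounds is the derivative. Oscillation occurs on a null set by
  \<open>null_sets_steep_flat\<close>, unboundedness by \<open>emeasure_steep_le\<close>.\<close>

lemma mono_on_differentiable_AE:
  fixes f :: "real \<Rightarrow> real"
  assumes mono: "mono_on {a..b} f"
  shows "AE x in lebesgue. x \<in> {a<..<b} \<longrightarrow> f differentiable (at x)"
proof -
  have le: "f y \<le> f z" if "a \<le> y" "y \<le> z" "z \<le> b" for y z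
    using that by (intro mono_onD[OF mono]) auto
  \<comment> \<open>Strict straddling makes these sets unions of open intervals, so they are open
    and hence measurable although \<open>f\<close> may be discontinuous.\<close>
  define St where "St = (\<lambda>p n. \<Union>{{u<..<v} | u v. a \<le> u \<and> v \<le> b \<and> v - u < 1 / real (Suc n) \<and> p * (v - u) < f v - f u})"
  define Fl where "Fl = (\<lambda>q n. \<Union>{{u<..<v} | u v. a \<le> u \<and> v \<le> b \<and> v - u < 1 / real (Suc n) \<and> f v - f u < q * (v - u)})"
  have small: "\<exists>n. 1 / real (Suc n) < d" if "0 < d" for d
    using that nat_approx_posE by blast
  have StI: "\<exists>u v. u < x \<and> x < v \<and> v - u < d \<and> a \<le> u \<and> v \<le> b \<and> p * (v - u) \<le> f v - f u"
    if "x \<in> (\<Inter>n. St p n)" "0 < d" for x p d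
  proof -
    obtain n where n: "1 / real (Suc n) < d" using small[OF \<open>0 < d\<close>] by blast
    have "x \<in> St p n" using that by blast
    with n show ?thesis unfolding St_def by force
  qed
  have FlI: "\<exists>u v. u < x \<and> x < v \<and> v - u < d \<and> f v - f u \<le> q * (v - u)"
    if "x \<in> (\<Inter>n. Fl q n)" "0 < d" for x q d
  proof -
    obtain n where n: "1 / real (Suc n) < d" using small[OF \<open>0 < d\<close>] by blast
    have "x \<in> Fl q n" using that by blast
    with n show ?thesis unfolding Fl_def by force
  qed
  have op: "open (St p n)" "open (Fl p n)" for p n
    unfolding St_def Fl_def by auto
  have sub: "St p n \<subseteq> {a<..<b}" for p n
    unfolding St_def by auto
  have meas: "(\<Inter>n. St p n) \<in> sets lebesgue" "(\<Inter>n. Fl p n) \<in> sets lebesgue" for p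
    using op by (auto intro!: sets.countable_INT' simp: borel_open)
  define Q where "Q = {(q, p). q \<in> \<rat> \<and> p \<in> \<rat> \<and> 0 < q \<and> q < (p::real)}"
  have "countable Q"
    by (rule countable_subset[of _ "\<rat> \<times> \<rat>"]) (auto simp: Q_def countable_rat)
  \<comment> \<open>The exceptional points: at all small scales there are slopes above
    \<open>p\<close> and slopes below \<open>q\<close> for some rationals \<open>0 < q < p\<close>,
    or slopes above every integer.\<close>
  define N where "N = (\<Union>(q, p)\<in>Q. (\<Inter>n. St p n) \<inter> (\<Inter>n. Fl q n)) \<union> (\<Inter>k. \<Inter>n. St (real (Suc k)) n)"
  have N1: "(\<Inter>n. St p n) \<inter> (\<Inter>n. Fl q n) \<in> null_sets lebesgue" if "0 < q" "q < p" for p q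
  proof (rule null_sets_steep_flat[OF mono that])
    show "(\<Inter>n. St p n) \<inter> (\<Inter>n. Fl q n) \<subseteq> {a<..<b}" using sub by blast
    show "\<exists>u v. u < x \<and> x < v \<and> v - u < d \<and> p * (v - u) \<le> f v - f u"
      if "x \<in> (\<Inter>n. St p n) \<inter> (\<Inter>n. Fl q n)" "0 < d" for x d
      using StI[of x p d] that by auto
  qed (use meas FlI in auto)
  have N2: "(\<Inter>k. \<Inter>n. St (real (Suc k)) n) \<in> null_sets lebesgue"
  proof (cases "a \<le> b")
    case True
    let ?S = "\<Inter>k. \<Inter>n. St (real (Suc k)) n"
    have S: "?S \<in> sets lebesgue" using meas by (auto intro!: sets.countable_INT')
    have bd: "ennreal (real (Suc k)) * emeasure lebesgue ?S \<le> ennreal (f b - f a)" for k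
    proof (rule emeasure_steep_le[OF mono True _ S])
      show "?S \<subseteq> {a<..<b}" using sub by blast
      show "\<exists>u v. u < v \<and> u \<le> x \<and> x \<le> v \<and> v - u < d \<and> real (Suc k) * (v - u) \<le> f v - f u"
        if "x \<in> ?S" "0 < d" for x d
        using StI[of x "real (Suc k)" d] that by (metis INT_E UNIV_I less_imp_le less_trans)
    qed auto
    have "emeasure lebesgue ?S \<le> ennreal (f b - f a)"
      using bd[of 0] by simp
    then obtain s where s: "emeasure lebesgue ?S = ennreal s" "0 \<le> s"
      by (cases "emeasure lebesgue ?S") (auto simp: top_unique)
    have "real (Suc k) * s \<le> f b - f a" for k
    proof -
      have "ennreal (real (Suc k) * s) \<le> ennreal (f b - f a)"
        using bd[of k] s by (metis ennreal_mult of_nat_0_le_iff)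
      then show ?thesis using le[of a b] True by simp
    qed
    note sk = this
    have "s \<le> 0"
    proof (rule ccontr)
      assume "\<not> s \<le> 0"
      then obtain k where "f b - f a < real k * s" using reals_Archimedean3[of s] by force
      also have "\<dots> \<le> real (Suc k) * s" using s(2) by (intro mult_right_mono) auto
      finally show False using sk[of k] by linarith
    qed
    then show ?thesis using s S by (auto simp: null_sets_def)
  next
    case False
    then have "(\<Inter>k. \<Inter>n. St (real (Suc k)) n) = {}" using sub by fastforce
    then show ?thesis by simp
  qed
  have N: "N \<in> null_sets lebesgue"
    unfolding N_def using N1 N2 \<open>countable Q\<close>
    by (intro null_sets.Un null_sets_UN') (auto simp: Q_def)
  have "f differentiable (at x)" if x: "x \<in> {a<..<b}" "x \<notin> N" for x
  proof -
    define P where "P = {p. p \<in> \<rat> \<and> 0 < p \<and> x \<notin> (\<Inter>n. St p n)}"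
    have "P \<noteq> {}"
    proof -
      obtain k where "x \<notin> (\<Inter>n. St (real (Suc k)) n)" using x(2) by (auto simp: N_def)
      then have "real (Suc k) \<in> P" unfolding P_def by (auto simp del: of_nat_Suc)
      then show ?thesis by blast
    qed
    have bdd: "bdd_below P" unfolding P_def by (rule bdd_belowI[of _ 0]) auto
    define L where "L = Inf P"
    have "0 \<le> L" unfolding L_def using \<open>P \<noteq> {}\<close> by (intro cInf_greatest) (auto simp: P_def)
    have up: "\<exists>d>0. \<forall>u v. a \<le> u \<longrightarrow> v \<le> b \<longrightarrow> u < x \<longrightarrow> x < v \<longrightarrow> v - u < d \<longrightarrow> f v - f u \<le> (L + e) * (v - u)"
      if "0 < e" for e
    proof -
      obtain p where p: "p \<in> P" "p < L + e"
        using cInf_less_iff[OF \<open>P \<noteq> {}\<close> bdd, of "L + e"] \<open>0 < e\<close> unfolding L_def by auto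
      then obtain n where n: "x \<notin> St p n" unfolding P_def by auto
      have "f v - f u \<le> (L + e) * (v - u)"
        if "a \<le> u" "v \<le> b" "u < x" "x < v" "v - u < 1 / real (Suc n)" for u v
      proof -
        have "f v - f u \<le> p * (v - u)" using n that unfolding St_def by force
        also have "\<dots> \<le> (L + e) * (v - u)" using p that by (intro mult_right_mono) auto
        finally show ?thesis .
      qed
      then show ?thesis by (intro exI[of _ "1 / real (Suc n)"]) auto
    qed
    have low: "\<exists>d>0. \<forall>u v. a \<le> u \<longrightarrow> v \<le> b \<longrightarrow> u < x \<longrightarrow> x < v \<longrightarrow> v - u < d \<longrightarrow> (L - e) * (v - u) \<le> f v - f u"
      if "0 < e" for e
    proof (cases "L - e \<le> 0")
      case True
      have "(L - e) * (v - u) \<le> f v - f u" if "a \<le> u" "v \<le> b" "u < x" "x < v" for u v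
      proof -
        have "(L - e) * (v - u) \<le> 0" using True that by (intro mult_nonpos_nonneg) auto
        also have "0 \<le> f v - f u" using le[of u v] that by auto
        finally show ?thesis .
      qed
      then show ?thesis by (intro exI[of _ 1]) auto
    next
      case False
      \<comment> \<open>Slopes above \<open>p\<close> recur at all scales because \<open>p\<close>
        lies below the infimum. Slopes below \<open>q\<close> cannot recur too, since
        \<open>x\<close> would then lie in \<open>N\<close>; so \<open>q\<close>, and with it
        \<open>L - e\<close>, is an eventual lower bound. The case split makes \<open>q\<close>
        positive, as membership in \<open>Q\<close> demands.\<close>
      obtain q where q: "q \<in> \<rat>" "L - e < q" "q < L" using Rats_dense_in_real[of "L - e" L] \<open>0 < e\<close> by auto
      obtain p where p: "p \<in> \<rat>" "q < p" "p < L" using Rats_dense_in_real[of q L] q by auto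
      have "p \<notin> P" using cInf_lower[OF _ bdd, of p] p unfolding L_def by auto
      then have "x \<in> (\<Inter>n. St p n)" using p q False by (auto simp: P_def)
      moreover have "(q, p) \<in> Q" using p q False by (auto simp: Q_def)
      ultimately have "x \<notin> (\<Inter>n. Fl q n)" using x(2) unfolding N_def by blast
      then obtain n where n: "x \<notin> Fl q n" by auto
      have "(L - e) * (v - u) \<le> f v - f u"
        if "a \<le> u" "v \<le> b" "u < x" "x < v" "v - u < 1 / real (Suc n)" for u v
      proof -
        have "(L - e) * (v - u) \<le> q * (v - u)" using q that by (intro mult_right_mono) auto
        also have "\<dots> \<le> f v - f u" using n that unfolding Fl_def by force
        finally show ?thesis .
      qed
      then show ?thesis by (intro exI[of _ "1 / real (Suc n)"]) auto
    qed
    have "(f has_real_derivative L) (at x)"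
    proof (rule straddle_differentiable[OF mono _ _ \<open>0 \<le> L\<close>])
      fix e :: real assume "0 < e"
      obtain d1 where d1: "0 < d1" "\<And>u v. a \<le> u \<Longrightarrow> v \<le> b \<Longrightarrow> u < x \<Longrightarrow> x < v \<Longrightarrow> v - u < d1 \<Longrightarrow> f v - f u \<le> (L + e) * (v - u)"
        using up[OF \<open>0 < e\<close>] by blast
      obtain d2 where d2: "0 < d2" "\<And>u v. a \<le> u \<Longrightarrow> v \<le> b \<Longrightarrow> u < x \<Longrightarrow> x < v \<Longrightarrow> v - u < d2 \<Longrightarrow> (L - e) * (v - u) \<le> f v - f u"
        using low[OF \<open>0 < e\<close>] by blast
      show "\<exists>d>0. \<forall>u v. a \<le> u \<longrightarrow> v \<le> b \<longrightarrow> u < x \<longrightarrow> x < v \<longrightarrow> v - u < d \<longrightarrow>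
        \<bar>f v - f u - L * (v - u)\<bar> \<le> e * (v - u)"
      proof (intro exI[of _ "min d1 d2"] conjI allI impI)
        fix u v assume "a \<le> u" "v \<le> b" "u < x" "x < v" "v - u < min d1 d2"
        with d1(2)[of u v] d2(2)[of u v] show "\<bar>f v - f u - L * (v - u)\<bar> \<le> e * (v - u)"
          by (auto simp: abs_le_iff algebra_simps)
      qed (use d1(1) d2(1) in simp)
    qed (use x in auto)
    then show ?thesis by (auto simp: real_differentiable_def)
  qed
  then show ?thesis by (intro AE_I'[OF N]) auto
qed

section \<open>Minimal cost flows on finite sets\<close>

text \<open>Sign convention: \<open>c (x, y)\<close> travels from \<open>x\<close> to
  \<open>y\<close>, so \<open>g\<close> is target minus source, as on the right-hand side of the
  current equation. Diagonal entries cancel in the divergence.\<close>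

definition flow :: "'a set \<Rightarrow> ('a \<Rightarrow> real) \<Rightarrow> ('a \<times> 'a \<Rightarrow> real) \<Rightarrow> bool" where
  "flow B g c \<longleftrightarrow> (\<forall>z\<in>B \<times> B. 0 \<le> c z) \<and>
     (\<forall>x\<in>B. (\<Sum>y\<in>B. c (y, x)) - (\<Sum>y\<in>B. c (x, y)) = g x)"

text \<open>The weight is a parameter because costs are also minimised for the distance plus a
  constant.\<close>

definition flow_cost :: "('a \<times> 'a \<Rightarrow> real) \<Rightarrow> 'a set \<Rightarrow> ('a \<times> 'a \<Rightarrow> real) \<Rightarrow> real" where
  "flow_cost w B c = (\<Sum>z\<in>B \<times> B. w z * c z)"

lemma flow_cong:
  assumes "\<And>z. z \<in> B \<times> B \<Longrightarrow> c z = c' z" "flow B g c"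
  shows "flow B g c'"
proof -
  have "(\<Sum>y\<in>B. c (y, x)) = (\<Sum>y\<in>B. c' (y, x))" "(\<Sum>y\<in>B. c (x, y)) = (\<Sum>y\<in>B. c' (x, y))"
    if "x \<in> B" for x
    using assms(1) that by (auto intro!: sum.cong)
  then show ?thesis using assms unfolding flow_def by simp
qed

lemma flow_cost_cong:
  "(\<And>z. z \<in> B \<times> B \<Longrightarrow> c z = c' z) \<Longrightarrow> flow_cost w B c = flow_cost w B c'"
  unfolding flow_cost_def by (intro sum.cong) auto

lemma flow_cost_nonneg:
  "(\<And>z. 0 \<le> w z) \<Longrightarrow> flow B g c \<Longrightarrow> 0 \<le> flow_cost w B c"
  unfolding flow_cost_def flow_def by (intro sum_nonneg mult_nonneg_nonneg) auto

text \<open>The cap \<open>K\<close> makes the feasible set compact, a product of intervals cut by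
  closed linear constraints. For the weight \<open>distance\<close> the cost alone gives no
  compactness, as diagonal entries can grow for free.\<close>

lemma bounded_flow_attains_min:
  assumes "finite B" and c0: "flow B g c0" "\<And>z. z \<in> B \<times> B \<Longrightarrow> c0 z \<le> K z"
  obtains c where "flow B g c" "\<And>z. z \<in> B \<times> B \<Longrightarrow> c z \<le> K z"
    "\<And>c'. flow B g c' \<Longrightarrow> (\<And>z. z \<in> B \<times> B \<Longrightarrow> c' z \<le> K z) \<Longrightarrow> flow_cost w B c \<le> flow_cost w B c'"
proof -
  \<comment> \<open>Entries outside \<open>B \<times> B\<close> are pinned to 0 so that the box is
    compact in the space of all functions; \<open>r\<close> below truncates a given flow
    accordingly.\<close>
  define S :: "('a \<times> 'a \<Rightarrow> real) set"
    where "S = PiE UNIV (\<lambda>z. if z \<in> B \<times> B then {0..K z} else {0})"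
  define D where "D = {c. \<forall>x\<in>B. (\<Sum>y\<in>B. c (y, x)) - (\<Sum>y\<in>B. c (x, y)) = g x}"
  define r where "r = (\<lambda>c z. if z \<in> B \<times> B then c z else (0::real))"
  have "compact S"
    using compactin_PiE[of "\<lambda>_. euclidean" UNIV "\<lambda>z. if z \<in> B \<times> B then {0..K z} else {0}"]
    unfolding S_def euclidean_product_topology compactin_euclidean_iff by auto
  moreover have "closed D"
  proof -
    have "D = (\<Inter>x\<in>B. {c. (\<Sum>y\<in>B. c (y, x)) - (\<Sum>y\<in>B. c (x, y)) = g x})"
      unfolding D_def by auto
    then show ?thesis
      by (auto intro!: closed_Collect_eq continuous_on_diff continuous_on_sum
          continuous_on_product_coordinates continuous_on_const)
  qed
  ultimately have "compact (S \<inter> D)" by (rule compact_Int_closed)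
  have r: "r c \<in> S \<inter> D" if c: "flow B g c" "\<And>z. z \<in> B \<times> B \<Longrightarrow> c z \<le> K z" for c
  proof -
    have "flow B g (r c)" by (rule flow_cong[OF _ c(1)]) (simp add: r_def)
    then have "r c \<in> D" by (simp add: flow_def D_def)
    moreover have "r c \<in> S" using c unfolding S_def r_def flow_def by auto
    ultimately show ?thesis by simp
  qed
  have "continuous_on (S \<inter> D) (flow_cost w B)"
    unfolding flow_cost_def
    by (intro continuous_intros continuous_on_subset[OF continuous_on_product_coordinates]) auto
  then obtain c where c: "c \<in> S \<inter> D" "\<And>c'. c' \<in> S \<inter> D \<Longrightarrow> flow_cost w B c \<le> flow_cost w B c'"
    using continuous_attains_inf[OF \<open>compact (S \<inter> D)\<close>, of "flow_cost w B"] r[OF c0] by blast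
  have box: "0 \<le> c z" "c z \<le> K z" if "z \<in> B \<times> B" for z
  proof -
    have "c z \<in> (if z \<in> B \<times> B then {0..K z} else {0})" using c(1) unfolding S_def by blast
    then show "0 \<le> c z" "c z \<le> K z" using that by auto
  qed
  show ?thesis
  proof (rule that[of c])
    show "flow B g c" using c(1) box unfolding flow_def D_def by auto
    show "flow_cost w B c \<le> flow_cost w B c'"
      if "flow B g c'" "\<And>z. z \<in> B \<times> B \<Longrightarrow> c' z \<le> K z" for c'
    proof -
      have "flow_cost w B (r c') = flow_cost w B c'"
        by (rule flow_cost_cong) (simp add: r_def)
      then show ?thesis using c(2)[OF r[OF that]] by simp
    qed
  qed (rule box)
qed

lemma flow_cost_add: "flow_cost w B (\<lambda>z. c z + c' z) = flow_cost w B c + flow_cost w B c'"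
  by (simp add: flow_cost_def algebra_simps sum.distrib)

lemma flow_cost_mult: "flow_cost w B (\<lambda>z. a * c z) = a * flow_cost w B c"
  by (simp add: flow_cost_def sum_distrib_left mult_ac)

lemma flow_cost_single:
  "finite B \<Longrightarrow> q \<in> B \<times> B \<Longrightarrow> flow_cost w B (\<lambda>z. of_bool (z = q)) = w q"
  by (simp add: flow_cost_def of_bool_def if_distrib[of "\<lambda>t. _ * t"] cong: if_cong)

text \<open>Adding a constant to the distance makes the triangle inequality strict, so a minimiser never
  routes mass through an intermediate point.\<close>

lemma exists_unrelayed_flow:
  fixes B :: "'a::metric_space set"
  assumes "finite B" and c0: "flow B g c0" and "0 < e"
  defines "w \<equiv> (\<lambda>(x, y). dist x y + e)"
  obtains c where "flow B g c" "flow_cost w B c \<le> flow_cost w B c0"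
    "\<And>x y z. x \<in> B \<Longrightarrow> y \<in> B \<Longrightarrow> z \<in> B \<Longrightarrow> c (x, z) = 0 \<or> c (z, y) = 0"
proof -
  have w: "e \<le> w z" for z by (auto simp: w_def split: prod.split)
  \<comment> \<open>Every weight is at least \<open>e\<close>, so a flow no dearer than
    \<open>c0\<close> has all entries at most \<open>K\<close>, and the cap excludes no competitor
    of interest.\<close>
  define K where "K = flow_cost w B c0 / e"
  have K: "c z \<le> K" if c: "flow B g c" "flow_cost w B c \<le> flow_cost w B c0" and z: "z \<in> B \<times> B" for c z
  proof -
    have "e * c z \<le> w z * c z" using w[of z] c(1) z by (intro mult_right_mono) (auto simp: flow_def)
    also have "\<dots> \<le> flow_cost w B c"
      unfolding flow_cost_def
    proof (intro member_le_sum z)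
      show "0 \<le> w p * c p" if "p \<in> B \<times> B - {z}" for p
      proof (intro mult_nonneg_nonneg)
        show "0 \<le> w p" using w[of p] \<open>0 < e\<close> by simp
        show "0 \<le> c p" using c(1) that unfolding flow_def by blast
      qed
    qed (use \<open>finite B\<close> in auto)
    finally show ?thesis using c(2) \<open>0 < e\<close> by (simp add: K_def field_simps)
  qed
  obtain c where c: "flow B g c" "\<And>z. z \<in> B \<times> B \<Longrightarrow> c z \<le> K"
    and min: "\<And>c'. flow B g c' \<Longrightarrow> (\<And>z. z \<in> B \<times> B \<Longrightarrow> c' z \<le> K) \<Longrightarrow> flow_cost w B c \<le> flow_cost w B c'"
    using bounded_flow_attains_min[OF \<open>finite B\<close> c0, of "\<lambda>_. K" w] K[OF c0] by blast
  have le0: "flow_cost w B c \<le> flow_cost w B c0" using min[OF c0] K[OF c0] by blast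
  have pos: "0 \<le> c z" if "z \<in> B \<times> B" for z using c(1) that by (auto simp: flow_def)
  show ?thesis
  proof (rule that[OF c(1) le0])
    fix x y z assume xyz: "x \<in> B" "y \<in> B" "z \<in> B"
    show "c (x, z) = 0 \<or> c (z, y) = 0"
    proof (rule ccontr)
      assume "\<not> ?thesis"
      then have p: "0 < c (x, z)" "0 < c (z, y)" using pos xyz by (auto simp: less_le)
      \<comment> \<open>Half of the minimum, because for \<open>x = y = z\<close> both subtractions
        below hit the same entry.\<close>
      define m where "m = min (c (x, z)) (c (z, y)) / 2"
      have m: "0 < m" "2 * m \<le> c (x, z)" "2 * m \<le> c (z, y)" using p by (auto simp: m_def)
      define \<delta> :: "'a \<times> 'a \<Rightarrow> 'a \<times> 'a \<Rightarrow> real" where "\<delta> = (\<lambda>q p. of_bool (p = q))"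
      \<comment> \<open>The amount \<open>m\<close> on the route from \<open>x\<close> through
        \<open>z\<close> to \<open>y\<close> is sent straight from \<open>x\<close> to
        \<open>y\<close>. This keeps the divergence and saves at least \<open>m * e\<close>.\<close>
      define c' where "c' = (\<lambda>p. c p + (m * \<delta> (x, y) p + ((- m) * \<delta> (x, z) p + (- m) * \<delta> (z, y) p)))"
      have \<delta>1: "(\<Sum>u\<in>B. \<delta> (a, b) (u, v)) = of_bool (v = b)" if "a \<in> B" for a b v
        using that \<open>finite B\<close> by (cases "v = b") (auto simp: \<delta>_def of_bool_def)
      have \<delta>2: "(\<Sum>u\<in>B. \<delta> (a, b) (v, u)) = of_bool (v = a)" if "b \<in> B" for a b v
        using that \<open>finite B\<close> by (cases "v = a") (auto simp: \<delta>_def of_bool_def)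
      have "flow B g c'"
        unfolding flow_def
      proof (intro conjI ballI)
        fix q assume "q \<in> B \<times> B"
        then have "0 \<le> c q" by (rule pos)
        then have "m * \<delta> (x, z) q \<le> c q / 2"
          using m(2) by (cases "q = (x, z)") (simp_all add: \<delta>_def)
        moreover have "m * \<delta> (z, y) q \<le> c q / 2"
          using m(3) \<open>0 \<le> c q\<close> by (cases "q = (z, y)") (simp_all add: \<delta>_def)
        moreover have "0 \<le> m * \<delta> (x, y) q" using m by (simp add: \<delta>_def)
        ultimately show "0 \<le> c' q" by (simp add: c'_def)
      next
        fix v assume "v \<in> B"
        have "(\<Sum>u\<in>B. c' (u, v)) = (\<Sum>u\<in>B. c (u, v)) + (m * of_bool (v = y) - m * of_bool (v = z) - m * of_bool (v = y))"
          unfolding c'_def sum.distrib sum_distrib_left[symmetric] using \<delta>1 xyz by simp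
        moreover have "(\<Sum>u\<in>B. c' (v, u)) = (\<Sum>u\<in>B. c (v, u)) + (m * of_bool (v = x) - m * of_bool (v = x) - m * of_bool (v = z))"
          unfolding c'_def sum.distrib sum_distrib_left[symmetric] using \<delta>2 xyz by simp
        ultimately show "(\<Sum>u\<in>B. c' (u, v)) - (\<Sum>u\<in>B. c' (v, u)) = g v"
          using c(1) \<open>v \<in> B\<close> by (simp add: flow_def)
      qed
      moreover have "flow_cost w B c' = flow_cost w B c + m * (w (x, y) - w (x, z) - w (z, y))"
        unfolding c'_def flow_cost_add flow_cost_mult \<delta>_def using \<open>finite B\<close> xyz
        by (simp add: flow_cost_single algebra_simps)
      moreover have "m * (w (x, y) - w (x, z) - w (z, y)) < 0"
        using m(1) \<open>0 < e\<close> dist_triangle[of x y z] by (auto simp: w_def mult_less_0_iff)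
      ultimately have c': "flow B g c'" "flow_cost w B c' < flow_cost w B c" by auto
      have "flow_cost w B c \<le> flow_cost w B c'"
        using K[OF c'(1)] c'(2) le0 by (intro min[OF c'(1)]) auto
      with c'(2) show False by simp
    qed
  qed
qed

section \<open>Optimal flows for the unperturbed distance\<close>

abbreviation "distance \<equiv> (\<lambda>(x, y). dist x y)"

text \<open>Under the perturbed weights any competitor can be replaced by an unrelayed flow, in
  which a point that emits mass receives none. The divergence of such a point is minus its whole
  outflow, and dually for receivers, which bounds every entry by \<open>K\<close>. The perturbation
  adds at most \<open>e\<close> times the mass of the competitor, so as \<open>e\<close> tends to 0
  the capped flows, a compact set, already realise the infimum over all flows.\<close>

lemma exists_optimal_flow:
  fixes B :: "'a::metric_space set"
  assumes "finite B" and c0: "flow B g c0"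
  obtains c where "flow B g c"
    "\<And>x y. x \<in> B \<Longrightarrow> y \<in> B \<Longrightarrow> c (x, y) \<le> max 0 (- g x) \<and> c (x, y) \<le> max 0 (g y)"
    "\<And>c'. flow B g c' \<Longrightarrow> flow_cost distance B c \<le> flow_cost distance B c'"
proof -
  define K where "K = (\<lambda>(x, y). min (max 0 (- g x)) (max 0 (g y)))"
  have tight: "\<exists>c. flow B g c \<and> (\<forall>z\<in>B \<times> B. c z \<le> K z) \<and>
      flow_cost distance B c \<le> flow_cost distance B c' + e * (\<Sum>z\<in>B \<times> B. c' z)"
    if c': "flow B g c'" and "0 < e" for c' e
  proof -
    obtain c where c: "flow B g c"
        "flow_cost (\<lambda>(x, y). dist x y + e) B c \<le> flow_cost (\<lambda>(x, y). dist x y + e) B c'"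
      and un: "\<And>x y z. x \<in> B \<Longrightarrow> y \<in> B \<Longrightarrow> z \<in> B \<Longrightarrow> c (x, z) = 0 \<or> c (z, y) = 0"
      by (rule exists_unrelayed_flow[OF \<open>finite B\<close> c' \<open>0 < e\<close>]) (rule that)
    have pos: "0 \<le> c z" if "z \<in> B \<times> B" for z using c(1) that by (auto simp: flow_def)
    have div: "(\<Sum>y\<in>B. c (y, x)) - (\<Sum>y\<in>B. c (x, y)) = g x" if "x \<in> B" for x
      using c(1) that by (auto simp: flow_def)
    have "c (x, y) \<le> max 0 (- g x)" "c (x, y) \<le> max 0 (g y)" if xy: "x \<in> B" "y \<in> B" for x y
    proof -
      have "c (x, y) \<le> - g x \<and> c (x, y) \<le> g y" if n: "c (x, y) \<noteq> 0"
      proof -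
        have "(\<Sum>u\<in>B. c (u, x)) = 0" "(\<Sum>u\<in>B. c (y, u)) = 0"
          using un[OF _ xy(2,1)] un[OF xy(1) _ xy(2)] n by (auto intro!: sum.neutral)
        moreover have "c (x, y) \<le> (\<Sum>u\<in>B. c (x, u))" "c (x, y) \<le> (\<Sum>u\<in>B. c (u, y))"
          using pos xy \<open>finite B\<close> member_le_sum[of y B "\<lambda>u. c (x, u)"] member_le_sum[of x B "\<lambda>u. c (u, y)"]
          by auto
        ultimately show ?thesis using div[OF xy(1)] div[OF xy(2)] by linarith
      qed
      then have "c (x, y) \<le> 0 \<or> c (x, y) \<le> - g x \<and> c (x, y) \<le> g y" by (metis order_refl)
      then show "c (x, y) \<le> max 0 (- g x)" "c (x, y) \<le> max 0 (g y)"
        unfolding le_max_iff_disj by blast+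
    qed
    then have "\<forall>z\<in>B \<times> B. c z \<le> K z" by (auto simp: K_def)
    moreover have "flow_cost (\<lambda>(x, y). dist x y + e) B b = flow_cost distance B b + e * (\<Sum>z\<in>B \<times> B. b z)"
      for b unfolding flow_cost_def sum_distrib_left sum.distrib[symmetric]
      by (intro sum.cong) (auto simp: algebra_simps)
    note exp = this
    have "0 \<le> e * (\<Sum>z\<in>B \<times> B. c z)"
      using \<open>0 < e\<close> pos by (intro mult_nonneg_nonneg sum_nonneg) auto
    then have "flow_cost distance B c \<le> flow_cost distance B c' + e * (\<Sum>z\<in>B \<times> B. c' z)"
      using c(2) exp[of c] exp[of c'] by linarith
    ultimately show ?thesis using c(1) by (intro exI[of _ c] conjI)
  qed
  obtain c1 where "flow B g c1" "\<forall>z\<in>B \<times> B. c1 z \<le> K z"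
    using tight[OF c0, of 1] by auto
  then obtain c where c: "flow B g c" "\<And>z. z \<in> B \<times> B \<Longrightarrow> c z \<le> K z"
    and min: "\<And>c'. flow B g c' \<Longrightarrow> (\<And>z. z \<in> B \<times> B \<Longrightarrow> c' z \<le> K z) \<Longrightarrow>
      flow_cost distance B c \<le> flow_cost distance B c'"
    using bounded_flow_attains_min[OF \<open>finite B\<close>, of g c1 K distance] by metis
  show ?thesis
  proof (rule that[OF c(1)])
    show "c (x, y) \<le> max 0 (- g x) \<and> c (x, y) \<le> max 0 (g y)" if "x \<in> B" "y \<in> B" for x y
      using c(2)[of "(x, y)"] that by (simp add: K_def)
    fix c' assume c': "flow B g c'"
    define M where "M = (\<Sum>z\<in>B \<times> B. c' z)"
    have "0 \<le> M" unfolding M_def using c' by (intro sum_nonneg) (auto simp: flow_def)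
    show "flow_cost distance B c \<le> flow_cost distance B c'"
    proof (rule field_le_epsilon)
      fix e :: real assume "0 < e"
      \<comment> \<open>The summand 1 guards against a competitor of total mass zero.\<close>
      then have "0 < e / (M + 1)" using \<open>0 \<le> M\<close> by simp
      from tight[OF c' this] obtain c'' where "flow B g c''" "\<forall>z\<in>B \<times> B. c'' z \<le> K z"
        "flow_cost distance B c'' \<le> flow_cost distance B c' + e / (M + 1) * M" unfolding M_def by blast
      moreover from this min have "flow_cost distance B c \<le> flow_cost distance B c''" by blast
      moreover have "e / (M + 1) * M \<le> e" using \<open>0 \<le> M\<close> \<open>0 < e\<close> by (simp add: field_simps)
      ultimately show "flow_cost distance B c \<le> flow_cost distance B c' + e" by linarith
    qed
  qed
qed

text \<open>All deficits are shipped to the hub \<open>r\<close> and all surpluses are served from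
  it. This shows that flows exist for every zero-sum divergence and bounds the minimal cost linearly
  in the values of \<open>g\<close>, which later gives continuity.\<close>

lemma exists_star_flow:
  fixes B :: "'a::metric_space set"
  assumes "finite B" "r \<in> B" "(\<Sum>x\<in>B. g x) = 0"
  obtains c where "flow B g c"
    "flow_cost distance B c = (\<Sum>x\<in>B. dist x r * \<bar>g x\<bar>)"
proof -
  define n where "n = (\<lambda>x. max 0 (- g x))"
  define p where "p = (\<lambda>x. max 0 (g x))"
  have np: "0 \<le> n x" "0 \<le> p x" "p x - n x = g x" "p x + n x = \<bar>g x\<bar>" for x
    by (auto simp: n_def p_def)
  have tot: "(\<Sum>x\<in>B. p x) = (\<Sum>x\<in>B. n x)"
    using assms(3) unfolding np(3)[symmetric] sum_subtractf by simp
  define c where "c = (\<lambda>(x, y). (if y = r then n x else 0) + (if x = r then p y else 0))"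
  have "flow B g c"
    unfolding flow_def
  proof (intro conjI ballI)
    fix x assume "x \<in> B"
    have "(\<Sum>y\<in>B. c (y, x)) = (if x = r then \<Sum>y\<in>B. n y else 0) + p x"
      using assms(1,2) by (auto simp: c_def sum.distrib)
    moreover have "(\<Sum>y\<in>B. c (x, y)) = n x + (if x = r then \<Sum>y\<in>B. p y else 0)"
      using assms(1,2) by (auto simp: c_def sum.distrib)
    ultimately show "(\<Sum>y\<in>B. c (y, x)) - (\<Sum>y\<in>B. c (x, y)) = g x"
      using tot np(3)[of x] by auto
  qed (auto simp: c_def np)
  moreover have "flow_cost distance B c = (\<Sum>x\<in>B. dist x r * \<bar>g x\<bar>)"
  proof -
    have "flow_cost distance B c = (\<Sum>x\<in>B. \<Sum>y\<in>B. dist x y * c (x, y))"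
      unfolding flow_cost_def by (simp add: sum.cartesian_product case_prod_unfold)
    also have "\<dots> = (\<Sum>x\<in>B. \<Sum>y\<in>B. (if y = r then dist x r * n x else 0) + (if x = r then dist r y * p y else 0))"
      by (intro sum.cong) (auto simp: c_def algebra_simps)
    also have "\<dots> = (\<Sum>x\<in>B. dist x r * n x) + (\<Sum>y\<in>B. dist r y * p y)"
      using assms(1,2) by (subst sum.distrib, subst sum.distrib, subst (2) sum.swap) (simp cong: sum.cong)
    also have "\<dots> = (\<Sum>x\<in>B. dist x r * \<bar>g x\<bar>)"
      unfolding np(4)[symmetric] by (simp add: sum.distrib[symmetric] algebra_simps dist_commute)
    finally show ?thesis .
  qed
  ultimately show ?thesis using that by blast
qed

text \<open>On a finite set, divergences sum to zero; for any other \<open>g\<close> this is the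
  infimum of an empty set and carries no information. Hence the zero-sum hypotheses below.\<close>

definition beckmann :: "'a::metric_space set \<Rightarrow> ('a \<Rightarrow> real) \<Rightarrow> real" where
  "beckmann B g = Inf (flow_cost distance B ` {c. flow B g c})"

lemma beckmann_le:
  assumes "flow B g c"
  shows "beckmann B g \<le> flow_cost distance B c"
  unfolding beckmann_def using assms
  by (intro cInf_lower bdd_belowI2[of _ 0] flow_cost_nonneg) (auto split: prod.split)

text \<open>The entrywise bounds are kept alongside optimality because both later constructions use
  them: couplings need rows that do not exceed the available mass, currents need massless points to
  emit nothing.\<close>

lemma beckmann_attained:
  fixes B :: "'a::metric_space set"
  assumes "finite B" "B \<noteq> {}" "(\<Sum>x\<in>B. g x) = 0"
  obtains c where "flow B g c" "flow_cost distance B c = beckmann B g"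
    "\<And>x y. x \<in> B \<Longrightarrow> y \<in> B \<Longrightarrow> c (x, y) \<le> max 0 (- g x) \<and> c (x, y) \<le> max 0 (g y)"
proof -
  obtain c0 where "flow B g c0" using exists_star_flow assms by (metis ex_in_conv)
  then obtain c where c: "flow B g c"
    "\<And>x y. x \<in> B \<Longrightarrow> y \<in> B \<Longrightarrow> c (x, y) \<le> max 0 (- g x) \<and> c (x, y) \<le> max 0 (g y)"
    "\<And>c'. flow B g c' \<Longrightarrow> flow_cost distance B c \<le> flow_cost distance B c'"
    using exists_optimal_flow[OF \<open>finite B\<close>] by blast
  have "flow_cost distance B c \<le> beckmann B g"
    unfolding beckmann_def using c by (intro cInf_greatest) auto
  then have "flow_cost distance B c = beckmann B g" using beckmann_le[OF c(1)] by simp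
  with c that show ?thesis by blast
qed

section \<open>Seminorm properties and continuity of the minimal flow cost\<close>

context
  fixes B :: "'a::metric_space set"
  assumes B: "finite B" "B \<noteq> {}"
begin

lemma beckmann_nonneg:
  assumes "(\<Sum>x\<in>B. g x) = 0"
  shows "0 \<le> beckmann B g"
proof -
  obtain c where "flow B g c" "flow_cost distance B c = beckmann B g"
    using beckmann_attained[OF B assms] by metis
  then show ?thesis using flow_cost_nonneg[of distance B g c] by (auto split: prod.split)
qed

lemma beckmann_add_le:
  assumes "(\<Sum>x\<in>B. g x) = 0" "(\<Sum>x\<in>B. h x) = 0"
  shows "beckmann B (\<lambda>x. g x + h x) \<le> beckmann B g + beckmann B h"
proof -
  obtain c where c: "flow B g c" "flow_cost distance B c = beckmann B g"
    using beckmann_attained[OF B assms(1)] by metis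
  obtain d where d: "flow B h d" "flow_cost distance B d = beckmann B h"
    using beckmann_attained[OF B assms(2)] by metis
  have "flow B (\<lambda>x. g x + h x) (\<lambda>z. c z + d z)"
    using c(1) d(1) unfolding flow_def by (auto simp: sum.distrib algebra_simps)
  from beckmann_le[OF this] show ?thesis using c d by (simp add: flow_cost_add)
qed

text \<open>Reversing all arrows negates the divergence and, by symmetry of the distance, preserves
  the cost.\<close>

lemma beckmann_minus_le:
  assumes "(\<Sum>x\<in>B. g x) = 0"
  shows "beckmann B (\<lambda>x. - g x) \<le> beckmann B g"
proof -
  obtain c where c: "flow B g c" "flow_cost distance B c = beckmann B g"
    using beckmann_attained[OF B assms] by metis
  have "flow B (\<lambda>x. - g x) (\<lambda>(x, y). c (y, x))"
    using c(1) unfolding flow_def by auto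
  moreover have "flow_cost distance B (\<lambda>(x, y). c (y, x)) = flow_cost distance B c"
    unfolding flow_cost_def
    by (intro sum.reindex_bij_witness[of _ prod.swap prod.swap]) (auto simp: dist_commute)
  ultimately show ?thesis using beckmann_le c by metis
qed

lemma beckmann_minus:
  assumes "(\<Sum>x\<in>B. g x) = 0"
  shows "beckmann B (\<lambda>x. - g x) = beckmann B g"
  using beckmann_minus_le[OF assms] beckmann_minus_le[of "\<lambda>x. - g x"] assms by (simp add: sum_negf)

lemma beckmann_mult_le:
  assumes "(\<Sum>x\<in>B. g x) = 0" "0 \<le> a"
  shows "beckmann B (\<lambda>x. a * g x) \<le> a * beckmann B g"
proof -
  obtain c where c: "flow B g c" "flow_cost distance B c = beckmann B g"
    using beckmann_attained[OF B assms(1)] by metis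
  have "flow B (\<lambda>x. a * g x) (\<lambda>z. a * c z)"
    using c(1) assms(2) unfolding flow_def by (auto simp: sum_distrib_left[symmetric] algebra_simps)
  from beckmann_le[OF this] show ?thesis using c by (simp add: flow_cost_mult)
qed

text \<open>For positive \<open>a\<close>, scaling down and back up gives the two inequalities;
  negative \<open>a\<close> is reduced to this by reversing flows. Both signs occur because time
  increments do.\<close>

lemma beckmann_divide:
  assumes g: "(\<Sum>x\<in>B. g x) = 0" and "a \<noteq> 0"
  shows "beckmann B (\<lambda>x. g x / a) = beckmann B g / \<bar>a\<bar>"
proof -
  have pos: "beckmann B (\<lambda>x. g x / a) = beckmann B g / a" if "0 < a" for a
  proof (rule antisym)
    show "beckmann B (\<lambda>x. g x / a) \<le> beckmann B g / a"
      using beckmann_mult_le[OF g, of "1 / a"] that by simp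
    have "beckmann B (\<lambda>x. a * (g x / a)) \<le> a * beckmann B (\<lambda>x. g x / a)"
      using that g by (intro beckmann_mult_le) (auto simp: sum_divide_distrib[symmetric])
    then show "beckmann B g / a \<le> beckmann B (\<lambda>x. g x / a)"
      using that by (simp add: field_simps)
  qed
  show ?thesis
  proof (cases "0 < a")
    case False
    then have "beckmann B (\<lambda>x. g x / - a) = beckmann B g / - a" using pos[of "- a"] \<open>a \<noteq> 0\<close> by simp
    then show ?thesis
      using False beckmann_minus[of "\<lambda>x. g x / a"] g by (simp add: sum_divide_distrib[symmetric])
  qed (use pos in simp)
qed

text \<open>Subadditivity and symmetry bound the difference of two costs by the cost of the
  difference, and the star flow bounds the latter by a weighted sum of coordinate differences. So
  the minimal cost is Lipschitz in the coordinates.\<close>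

lemma tendsto_beckmann:
  assumes lim: "\<And>x. x \<in> B \<Longrightarrow> ((\<lambda>h. G h x) \<longlongrightarrow> g x) F"
    and zero: "(\<Sum>x\<in>B. g x) = 0" "\<forall>\<^sub>F h in F. (\<Sum>x\<in>B. G h x) = 0"
  shows "((\<lambda>h. beckmann B (G h)) \<longlongrightarrow> beckmann B g) F"
proof -
  obtain r where r: "r \<in> B" using B by blast
  have bound: "\<bar>beckmann B f - beckmann B g\<bar> \<le> (\<Sum>x\<in>B. dist x r * \<bar>f x - g x\<bar>)"
    if f: "(\<Sum>x\<in>B. f x) = 0" for f
  proof -
    have d: "(\<Sum>x\<in>B. f x - g x) = 0" using f zero(1) by (simp add: sum_subtractf)
    have "beckmann B f \<le> beckmann B g + beckmann B (\<lambda>x. f x - g x)"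
      using beckmann_add_le[OF zero(1) d] by simp
    moreover have "beckmann B g \<le> beckmann B f + beckmann B (\<lambda>x. f x - g x)"
      using beckmann_add_le[of f "\<lambda>x. - (f x - g x)"] beckmann_minus[OF d] f zero(1)
      by (simp add: sum_subtractf)
    moreover have "beckmann B (\<lambda>x. f x - g x) \<le> (\<Sum>x\<in>B. dist x r * \<bar>f x - g x\<bar>)"
      using exists_star_flow[OF B(1) r d] beckmann_le by metis
    ultimately show ?thesis by linarith
  qed
  have "((\<lambda>h. \<Sum>x\<in>B. dist x r * \<bar>G h x - g x\<bar>) \<longlongrightarrow> (\<Sum>x\<in>B. dist x r * \<bar>g x - g x\<bar>)) F"
    using lim by (intro tendsto_intros) auto
  then have lim0: "((\<lambda>h. \<Sum>x\<in>B. dist x r * \<bar>G h x - g x\<bar>) \<longlongrightarrow> 0) F" by simp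
  have "((\<lambda>h. beckmann B (G h) - beckmann B g) \<longlongrightarrow> 0) F"
    by (rule Lim_null_comparison[OF _ lim0]) (use zero(2) bound in \<open>auto elim!: eventually_mono\<close>)
  then show ?thesis by (simp add: LIM_zero_iff)
qed

end

section \<open>The Wasserstein distance on a discrete space\<close>

lemma sets_borel_discrete:
  assumes "\<And>S :: 'a::topological_space set. open S"
  shows "sets (borel :: 'a measure) = UNIV"
  using assms by (auto intro: borel_open)

lemma open_prod_discrete:
  assumes "\<And>S :: 'a::topological_space set. open S"
  shows "open (S :: ('a \<times> 'a) set)"
proof -
  have "S = (\<Union>z\<in>S. {fst z} \<times> {snd z})" by auto
  also have "open \<dots>" using assms by (intro open_UN ballI open_Times) auto
  finally show ?thesis .
qed

context
  assumes discrete: "\<And>S :: 'a::metric_space set. open S"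
begin

lemma sets_discrete: "sets (\<mu> :: 'a measure) = sets borel \<Longrightarrow> A \<in> sets \<mu>"
  using sets_borel_discrete[OF discrete] by simp

lemma sets_pair_discrete: "sets (\<pi> :: ('a \<times> 'a) measure) = sets borel \<Longrightarrow> A \<in> sets \<pi>"
  using sets_borel_discrete[OF open_prod_discrete[OF discrete]] by simp

lemma coupling_marginals:
  fixes \<mu> \<nu> :: "'a measure"
  assumes "\<pi> \<in> couplings \<mu> \<nu>"
  shows "measure \<mu> A = measure \<pi> (A \<times> UNIV)" "measure \<nu> A = measure \<pi> (UNIV \<times> A)"
proof -
  have sp: "sets \<pi> = sets borel" using assms by (simp add: couplings_def)
  have "space \<pi> = UNIV" using sets_eq_imp_space_eq[OF sp] by simp
  moreover have "\<mu> = distr \<pi> borel fst" "\<nu> = distr \<pi> borel snd"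
    using assms by (auto simp: couplings_def)
  moreover have "f \<in> measurable \<pi> borel" for f :: "'a \<times> 'a \<Rightarrow> 'a"
    using sets_pair_discrete[OF sp] by (simp add: measurable_def)
  moreover have "(fst :: 'a \<times> 'a \<Rightarrow> 'a) -` A = A \<times> UNIV" "(snd :: 'a \<times> 'a \<Rightarrow> 'a) -` A = UNIV \<times> A"
    by auto
  ultimately show "measure \<mu> A = measure \<pi> (A \<times> UNIV)" "measure \<nu> A = measure \<pi> (UNIV \<times> A)"
    using sets_borel_discrete[OF discrete] by (simp_all add: measure_distr)
qed

text \<open>In a coupling, the pairs starting at \<open>x\<close> and the pairs ending at
  \<open>x\<close> share the diagonal pair \<open>(x, x)\<close>. The discrepancy of the two atoms
  is therefore carried by pairs with exactly one coordinate equal to \<open>x\<close>, each of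
  length at least \<open>r\<close>.\<close>

lemma atom_diff_le_W1:
  fixes \<mu> \<nu> :: "'a measure"
  assumes "0 \<le> r" and r: "\<And>y. y \<noteq> x \<Longrightarrow> r \<le> dist x y"
  shows "ennreal (r * \<bar>measure \<mu> {x} - measure \<nu> {x}\<bar>) \<le> W1 \<mu> \<nu>"
  unfolding W1_def
proof (rule INF_greatest)
  fix \<pi> assume \<pi>: "\<pi> \<in> couplings \<mu> \<nu>"
  then have sp: "sets \<pi> = sets borel" and "prob_space \<pi>" by (auto simp: couplings_def)
  then interpret prob_space \<pi> by simp
  note [simp] = sets_pair_discrete[OF sp]
  define A where "A = {z. fst z \<noteq> snd z \<and> (fst z = x \<or> snd z = x)}"
  have "measure \<mu> {x} \<le> measure \<pi> (UNIV \<times> {x} \<union> A)" "measure \<nu> {x} \<le> measure \<pi> ({x} \<times> UNIV \<union> A)"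
    unfolding coupling_marginals[OF \<pi>] by (intro finite_measure_mono; auto simp: A_def)+
  moreover have "measure \<pi> (B \<union> A) \<le> measure \<pi> B + measure \<pi> A" for B
    by (rule measure_Un_le) auto
  ultimately have "measure \<mu> {x} \<le> measure \<nu> {x} + measure \<pi> A" "measure \<nu> {x} \<le> measure \<mu> {x} + measure \<pi> A"
    unfolding coupling_marginals[OF \<pi>] by (meson order_trans)+
  then have "r * \<bar>measure \<mu> {x} - measure \<nu> {x}\<bar> \<le> r * measure \<pi> A"
    using \<open>0 \<le> r\<close> by (intro mult_left_mono) auto
  then have "ennreal (r * \<bar>measure \<mu> {x} - measure \<nu> {x}\<bar>) \<le> ennreal (r * measure \<pi> A)"
    by (rule ennreal_leI)
  also have "\<dots> = ennreal r * emeasure \<pi> A"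
    using \<open>0 \<le> r\<close> by (simp add: emeasure_eq_measure ennreal_mult)
  also have "\<dots> = (\<integral>\<^sup>+z. ennreal r * indicator A z \<partial>\<pi>)"
    by (simp add: nn_integral_cmult_indicator)
  also have "\<dots> \<le> (\<integral>\<^sup>+z. ennreal (dist (fst z) (snd z)) \<partial>\<pi>)"
    by (intro nn_integral_mono)
      (auto simp: A_def indicator_def dist_commute[of _ x] intro!: ennreal_leI r)
  finally show "ennreal (r * \<bar>measure \<mu> {x} - measure \<nu> {x}\<bar>)
    \<le> (\<integral>\<^sup>+z. ennreal (dist (fst z) (snd z)) \<partial>\<pi>)" .
qed

context
  assumes countable: "countable (UNIV :: 'a set)"
begin

lemma measure_outside_support:
  fixes \<mu> :: "'a measure"
  assumes "\<mu> \<in> prob_measures" "\<And>x. x \<notin> B \<Longrightarrow> measure \<mu> {x} = 0"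
  shows "measure \<mu> (- B) = 0"
proof -
  interpret prob_space \<mu> using assms by (simp add: prob_measures_def)
  have s: "A \<in> sets \<mu>" for A using assms sets_discrete by (auto simp: prob_measures_def)
  have "(\<Union>x\<in>- B. {x}) \<in> null_sets \<mu>"
    using assms countable_subset[OF _ countable, of "- B"] s
    by (intro null_sets_UN') (auto simp: null_sets_def emeasure_eq_measure)
  then show ?thesis by (simp add: null_sets_def emeasure_eq_measure)
qed

lemma sum_measure_support:
  fixes \<mu> :: "'a measure"
  assumes "\<mu> \<in> prob_measures" "\<And>x. x \<notin> B \<Longrightarrow> measure \<mu> {x} = 0" "finite B"
  shows "(\<Sum>x\<in>B. measure \<mu> {x}) = 1"
proof -
  interpret prob_space \<mu> using assms by (simp add: prob_measures_def)
  have s: "A \<in> sets \<mu>" for A using assms sets_discrete by (auto simp: prob_measures_def)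
  have sp: "space \<mu> = UNIV" using assms sets_eq_imp_space_eq[of \<mu> borel] by (simp add: prob_measures_def)
  have "measure \<mu> (- B) = 1 - measure \<mu> B" using prob_compl[of B] s sp by (simp add: Compl_eq_Diff_UNIV)
  then have "measure \<mu> B = 1" using measure_outside_support[OF assms(1,2)] by simp
  moreover have "measure \<mu> B = (\<Sum>x\<in>B. measure \<mu> {x})"
    using assms(3) s by (intro finite_measure_eq_sum_singleton) auto
  ultimately show ?thesis by simp
qed

text \<open>The point masses of a coupling form a flow that costs no more than the coupling. In the
  other direction a tight optimal flow becomes a coupling of the same cost once the mass that stays
  in place is put on the diagonal.\<close>

lemma W1_eq_beckmann:
  fixes \<mu> \<nu> :: "'a measure"
  assumes \<mu>: "\<mu> \<in> prob_measures" "\<And>x. x \<notin> B \<Longrightarrow> measure \<mu> {x} = 0"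
    and \<nu>: "\<nu> \<in> prob_measures" "\<And>x. x \<notin> B \<Longrightarrow> measure \<nu> {x} = 0"
    and B: "finite B" "B \<noteq> {}"
  shows "W1 \<mu> \<nu> = ennreal (beckmann B (\<lambda>x. measure \<nu> {x} - measure \<mu> {x}))"
proof (rule antisym)
  let ?g = "\<lambda>x. measure \<nu> {x} - measure \<mu> {x}"
  have zero: "(\<Sum>x\<in>B. ?g x) = 0"
    using sum_measure_support[OF \<mu> B(1)] sum_measure_support[OF \<nu> B(1)] by (simp add: sum_subtractf)
  show "ennreal (beckmann B ?g) \<le> W1 \<mu> \<nu>"
    unfolding W1_def
  proof (rule INF_greatest)
    fix \<pi> assume \<pi>: "\<pi> \<in> couplings \<mu> \<nu>"
    then have sp: "sets \<pi> = sets borel" and "prob_space \<pi>" by (auto simp: couplings_def)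
    then interpret prob_space \<pi> by simp
    note [simp] = sets_pair_discrete[OF sp]
    have [simp]: "f \<in> borel_measurable \<pi>" for f :: "'a \<times> 'a \<Rightarrow> ennreal"
      by (simp add: measurable_def)
    define c where "c = (\<lambda>z. measure \<pi> {z})"
    \<comment> \<open>Columns outside \<open>B\<close> carry no mass, because the second marginal
      does not charge them; summing over \<open>B\<close> recovers the whole row.\<close>
    have out: "(\<Sum>y\<in>B. c (x, y)) = measure \<mu> {x}" for x
    proof -
      have "measure \<mu> {x} = measure \<pi> ({x} \<times> B \<union> {x} \<times> (- B))"
        unfolding coupling_marginals[OF \<pi>] by (simp add: Sigma_Un_distrib2[symmetric])
      also have "\<dots> = measure \<pi> ({x} \<times> B)"
        using finite_measure_mono[of "{x} \<times> (- B)" "UNIV \<times> (- B)"] measure_outside_support[OF \<nu>]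
        unfolding coupling_marginals(2)[OF \<pi>]
        by (intro measure_Un_null_set) (auto simp: null_sets_def emeasure_eq_measure measure_le_0_iff)
      also have "\<dots> = (\<Sum>z\<in>{x} \<times> B. c z)"
        unfolding c_def using B by (intro finite_measure_eq_sum_singleton) auto
      also have "\<dots> = (\<Sum>y\<in>B. c (x, y))"
        by (intro sum.reindex_bij_witness[of _ "Pair x" snd]) auto
      finally show ?thesis by simp
    qed
    have inn: "(\<Sum>y\<in>B. c (y, x)) = measure \<nu> {x}" for x
    proof -
      have "measure \<nu> {x} = measure \<pi> (B \<times> {x} \<union> (- B) \<times> {x})"
        unfolding coupling_marginals[OF \<pi>] by (simp add: Sigma_Un_distrib1[symmetric])
      also have "\<dots> = measure \<pi> (B \<times> {x})"
        using finite_measure_mono[of "(- B) \<times> {x}" "(- B) \<times> UNIV"] measure_outside_support[OF \<mu>]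
        unfolding coupling_marginals(1)[OF \<pi>]
        by (intro measure_Un_null_set) (auto simp: null_sets_def emeasure_eq_measure measure_le_0_iff)
      also have "\<dots> = (\<Sum>z\<in>B \<times> {x}. c z)"
        unfolding c_def using B by (intro finite_measure_eq_sum_singleton) auto
      also have "\<dots> = (\<Sum>y\<in>B. c (y, x))"
        by (intro sum.reindex_bij_witness[of _ "\<lambda>y. (y, x)" fst]) auto
      finally show ?thesis by simp
    qed
    have "flow B ?g c" unfolding flow_def using out inn by (auto simp: c_def)
    then have "ennreal (beckmann B ?g) \<le> ennreal (flow_cost distance B c)"
      by (intro ennreal_leI beckmann_le)
    also have "\<dots> = (\<Sum>z\<in>B \<times> B. ennreal (dist (fst z) (snd z)) * emeasure \<pi> {z})"
      by (simp add: flow_cost_def c_def emeasure_eq_measure ennreal_mult[symmetric] case_prod_unfold)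
    also have "\<dots> = (\<integral>\<^sup>+p. (\<Sum>z\<in>B \<times> B. ennreal (dist (fst z) (snd z)) * indicator {z} p) \<partial>\<pi>)"
      using B by (subst nn_integral_sum) auto
    also have "\<dots> \<le> (\<integral>\<^sup>+z. ennreal (dist (fst z) (snd z)) \<partial>\<pi>)"
    proof (intro nn_integral_mono)
      fix p
      have "(\<Sum>z\<in>B \<times> B. ennreal (dist (fst z) (snd z)) * indicator {z} p)
          = (\<Sum>z\<in>B \<times> B. if z = p then ennreal (dist (fst p) (snd p)) else 0)"
        by (intro sum.cong) (auto simp: indicator_def)
      also have "\<dots> \<le> ennreal (dist (fst p) (snd p))" using B by simp
      finally show "(\<Sum>z\<in>B \<times> B. ennreal (dist (fst z) (snd z)) * indicator {z} p) \<le> ennreal (dist (fst p) (snd p))" .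
    qed
    finally show "ennreal (beckmann B ?g) \<le> (\<integral>\<^sup>+z. ennreal (dist (fst z) (snd z)) \<partial>\<pi>)" .
  qed
  obtain c where c: "flow B ?g c" "flow_cost distance B c = beckmann B ?g"
    and tight: "\<And>x y. x \<in> B \<Longrightarrow> y \<in> B \<Longrightarrow> c (x, y) \<le> max 0 (- ?g x) \<and> c (x, y) \<le> max 0 (?g y)"
    by (rule beckmann_attained[OF B zero]) (rule that)
  have c0: "0 \<le> c z" if "z \<in> B \<times> B" for z using c(1) that unfolding flow_def by blast
  have div: "(\<Sum>y\<in>B. c (y, x)) - (\<Sum>y\<in>B. c (x, y)) = ?g x" if "x \<in> B" for x
    using c(1) that unfolding flow_def by blast
  \<comment> \<open>The common part of the two masses stays put and costs nothing; the flow moves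
    only the excess.\<close>
  define p where "p = (\<lambda>z. if z \<in> B \<times> B then c z + (if fst z = snd z then min (measure \<mu> {fst z}) (measure \<nu> {fst z}) else 0) else 0)"
  have p0: "0 \<le> p z" for z using c0[of z] by (simp add: p_def)
  have rows: "(\<Sum>y\<in>B. p (x, y)) = measure \<mu> {x}" "(\<Sum>y\<in>B. p (y, x)) = measure \<nu> {x}" if x: "x \<in> B" for x
  proof -
    have "(\<Sum>y\<in>B. p (x, y)) = (\<Sum>y\<in>B. c (x, y)) + min (measure \<mu> {x}) (measure \<nu> {x})"
      "(\<Sum>y\<in>B. p (y, x)) = (\<Sum>y\<in>B. c (y, x)) + min (measure \<mu> {x}) (measure \<nu> {x})"
      using x B by (simp_all add: p_def sum.distrib cong: sum.cong)
    \<comment> \<open>By the entrywise bounds a point is a pure source or a pure sink: without a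
      deficit nothing departs, without a surplus nothing arrives. The surviving sum is the
      difference of the masses, and adding their minimum yields the marginal.\<close>
    moreover have "(\<Sum>y\<in>B. c (x, y)) = 0" if "0 \<le> ?g x"
      using tight[OF x] c0 x that by (intro sum.neutral ballI antisym) fastforce+
    moreover have "(\<Sum>y\<in>B. c (y, x)) = 0" if "?g x \<le> 0"
      using tight[OF _ x] c0 x that by (intro sum.neutral ballI antisym) fastforce+
    ultimately show "(\<Sum>y\<in>B. p (x, y)) = measure \<mu> {x}" "(\<Sum>y\<in>B. p (y, x)) = measure \<nu> {x}"
      using div[OF x] by linarith+
  qed
  define \<pi> where "\<pi> = density (count_space UNIV) (\<lambda>z. ennreal (p z))"
  have sets\<pi>: "sets \<pi> = sets borel"
    using sets_borel_discrete[OF open_prod_discrete[OF discrete]] by (simp add: \<pi>_def)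
  have em: "emeasure \<pi> A = ennreal (\<Sum>z\<in>B \<times> B. p z * indicator A z)" for A
  proof -
    have "emeasure \<pi> A = (\<integral>\<^sup>+z. ennreal (p z) * indicator A z \<partial>count_space UNIV)"
      by (simp add: \<pi>_def emeasure_density)
    also have "\<dots> = (\<Sum>z\<in>B \<times> B. ennreal (p z) * indicator A z)"
      using B by (intro nn_integral_count_space') (auto simp: p_def)
    also have "\<dots> = (\<Sum>z\<in>B \<times> B. ennreal (p z * indicator A z))"
      by (intro sum.cong) (auto simp: indicator_def)
    also have "\<dots> = ennreal (\<Sum>z\<in>B \<times> B. p z * indicator A z)"
      using p0 by (intro sum_ennreal) auto
    finally show ?thesis .
  qed
  have prob: "prob_space \<mu>" "prob_space \<nu>" "sets \<mu> = sets borel" "sets \<nu> = sets borel"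
    using \<mu> \<nu> by (auto simp: prob_measures_def)
  have em_dist: "emeasure (distr \<pi> borel f) A = emeasure \<pi> (f -` A)" for f :: "'a \<times> 'a \<Rightarrow> 'a" and A
    using sets_borel_discrete[OF discrete] by (subst emeasure_distr) (auto simp: \<pi>_def measurable_def)
  have marg: "distr \<pi> borel fst = \<mu>" "distr \<pi> borel snd = \<nu>"
  proof -
    have "emeasure (distr \<pi> borel fst) {x} = emeasure \<mu> {x}" for x
    proof -
      have "(\<Sum>z\<in>B \<times> B. p z * indicator (fst -` {x}) z) = (\<Sum>u\<in>B. \<Sum>y\<in>B. p (u, y) * indicator {x} u)"
        by (simp add: sum.cartesian_product case_prod_unfold indicator_def)
      also have "\<dots> = (\<Sum>u\<in>B. if u = x then measure \<mu> {x} else 0)"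
        by (intro sum.cong) (auto simp: indicator_def rows)
      also have "\<dots> = measure \<mu> {x}" using B \<mu>(2) by auto
      finally show ?thesis
        unfolding em_dist em by (simp add: finite_measure.emeasure_eq_measure prob_space.finite_measure prob)
    qed
    then show "distr \<pi> borel fst = \<mu>"
      using prob sets_borel_discrete[OF discrete]
      by (intro measure_eqI_countable[where A = UNIV] countable) auto
    have "emeasure (distr \<pi> borel snd) {x} = emeasure \<nu> {x}" for x
    proof -
      have "(\<Sum>z\<in>B \<times> B. p z * indicator (snd -` {x}) z) = (\<Sum>u\<in>B. \<Sum>y\<in>B. p (u, y) * indicator {x} y)"
        by (simp add: sum.cartesian_product case_prod_unfold indicator_def)
      also have "\<dots> = (\<Sum>y\<in>B. if y = x then measure \<nu> {x} else 0)"
        by (subst sum.swap, intro sum.cong) (auto simp: indicator_def rows)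
      also have "\<dots> = measure \<nu> {x}" using B \<nu>(2) by auto
      finally show ?thesis
        unfolding em_dist em by (simp add: finite_measure.emeasure_eq_measure prob_space.finite_measure prob)
    qed
    then show "distr \<pi> borel snd = \<nu>"
      using prob sets_borel_discrete[OF discrete]
      by (intro measure_eqI_countable[where A = UNIV] countable) auto
  qed
  have "prob_space \<pi>"
  proof (rule prob_spaceI)
    have "emeasure \<pi> (space \<pi>) = emeasure (distr \<pi> borel fst) UNIV" unfolding em_dist by (simp add: \<pi>_def)
    also have "\<dots> = 1"
      using prob_space.emeasure_space_1[OF prob(1)] sets_eq_imp_space_eq[OF prob(3)] by (simp add: marg)
    finally show "emeasure \<pi> (space \<pi>) = 1" .
  qed
  then have "\<pi> \<in> couplings \<mu> \<nu>" using sets\<pi> marg by (simp add: couplings_def)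
  then have "W1 \<mu> \<nu> \<le> (\<integral>\<^sup>+z. ennreal (dist (fst z) (snd z)) \<partial>\<pi>)"
    unfolding W1_def by (rule INF_lower)
  also have "\<dots> = (\<integral>\<^sup>+z. ennreal (p z) * ennreal (dist (fst z) (snd z)) \<partial>count_space UNIV)"
    by (simp add: \<pi>_def nn_integral_density)
  also have "\<dots> = (\<Sum>z\<in>B \<times> B. ennreal (p z) * ennreal (dist (fst z) (snd z)))"
    using B by (intro nn_integral_count_space') (auto simp: p_def)
  also have "\<dots> = ennreal (\<Sum>z\<in>B \<times> B. p z * dist (fst z) (snd z))"
    using p0 by (simp add: ennreal_mult[symmetric])
  also have "(\<Sum>z\<in>B \<times> B. p z * dist (fst z) (snd z)) = flow_cost distance B c"
    unfolding flow_cost_def by (intro sum.cong) (auto simp: p_def)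
  finally show "W1 \<mu> \<nu> \<le> ennreal (beckmann B ?g)" using c(2) by simp
qed

end

end

section \<open>Atoms of curves of bounded variation\<close>

text \<open>Appending \<open>t\<close> to a partition of \<open>[a, s]\<close> yields one of
  \<open>[a, t]\<close>. The result makes the increments of the variation function dominate
  \<open>W1\<close> between the two times.\<close>

lemma variation_add_le:
  assumes "a \<le> s" "s < t"
  shows "variation {a..s} \<nu> + W1 (\<nu> s) (\<nu> t) \<le> variation {a..t} \<nu>"
proof -
  define S where "S = (\<lambda>(k::nat, \<tau>::nat \<Rightarrow> real). \<Sum>i\<le>k. W1 (\<nu> (\<tau> i)) (\<nu> (\<tau> (i+1))))"
  define Q where "Q = (\<lambda>I. {(k::nat, \<tau>::nat \<Rightarrow> real). strict_mono_on {..k+1} \<tau> \<and> \<tau> ` {..k+1} \<subseteq> I})"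
  have var: "variation I \<nu> = (SUP p\<in>Q I. S p)" for I
    unfolding variation_def Q_def S_def by simp
  \<comment> \<open>A partition with parameter \<open>k\<close> has its last point at index
    \<open>k + 1\<close>, so the new point goes to index \<open>k + 2\<close> and the parameter
    rises by one.\<close>
  have ext: "(k + 1, \<tau>(k + 2 := u)) \<in> Q I \<and> S (k + 1, \<tau>(k + 2 := u)) = S (k, \<tau>) + W1 (\<nu> (\<tau> (k + 1))) (\<nu> u)"
    if "(k, \<tau>) \<in> Q I" "\<tau> (k + 1) < u" "u \<in> I" for k \<tau> u I
  proof -
    have sm: "strict_mono_on {..k+1} \<tau>" and im: "\<tau> ` {..k+1} \<subseteq> I" using that(1) by (auto simp: Q_def)
    have "\<tau> i < u" if "i \<le> k + 1" for i
      using strict_mono_onD[OF sm, of i "k + 1"] that \<open>\<tau> (k + 1) < u\<close> by (cases "i = k + 1") auto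
    then have "strict_mono_on {..k+2} (\<tau>(k + 2 := u))"
      using sm by (auto simp: strict_mono_on_def)
    moreover have "(\<tau>(k + 2 := u)) ` {..k+2} \<subseteq> I"
      using im \<open>u \<in> I\<close> by (auto simp: image_subset_iff)
    ultimately show ?thesis by (auto simp: Q_def S_def intro!: sum.cong)
  qed
  have mono: "Q I \<subseteq> Q J" if "I \<subseteq> J" for I J using that by (auto simp: Q_def)
  have sub: "{a..s} \<subseteq> {a..t}" "s \<in> {a..t}" "t \<in> {a..t}" using assms by auto
  show ?thesis
  proof (cases "a = s")
    case True
    \<comment> \<open>Partitions have at least two points, so a degenerate interval admits none and
      its variation is the empty supremum 0. The addition cannot be pulled into an empty supremum,
      hence the separate case.\<close>
    have "Q {a..s} = {}"
    proof (rule ccontr)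
      assume "Q {a..s} \<noteq> {}"
      then obtain k :: nat and \<tau> :: "nat \<Rightarrow> real"
        where \<tau>: "strict_mono_on {..k+1} \<tau>" "\<tau> ` {..k+1} \<subseteq> {a..s}"
        by (auto simp: Q_def simp del: One_nat_def)
      have "\<tau> 0 < \<tau> (k + 1)" by (rule strict_mono_onD[OF \<tau>(1)]) auto
      moreover have "\<tau> 0 \<in> {a..s}" "\<tau> (k + 1) \<in> {a..s}" using \<tau>(2) by (simp_all add: image_subset_iff)
      ultimately show False using True by simp
    qed
    then have "variation {a..s} \<nu> = 0" by (simp add: var bot_ennreal)
    moreover have "(0, \<lambda>i. if i = 0 then s else t) \<in> Q {a..t}"
      using assms by (auto simp: Q_def strict_mono_on_def)
    then have "S (0, \<lambda>i. if i = 0 then s else t) \<le> variation {a..t} \<nu>"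
      unfolding var by (rule SUP_upper)
    ultimately show ?thesis by (simp add: S_def)
  next
    case False
    have "(0, \<lambda>i. if i = 0 then a else s) \<in> Q {a..s}"
      using assms False by (auto simp: Q_def strict_mono_on_def)
    then have "variation {a..s} \<nu> + W1 (\<nu> s) (\<nu> t) = (SUP p\<in>Q {a..s}. S p + W1 (\<nu> s) (\<nu> t))"
      unfolding var by (subst ennreal_SUP_add_left) auto
    also have "\<dots> \<le> variation {a..t} \<nu>"
    proof (rule SUP_least)
      fix p assume p: "p \<in> Q {a..s}"
      obtain k \<tau> where p_eq: "p = (k, \<tau>)" by (cases p)
      have Qt: "(k, \<tau>) \<in> Q {a..t}" using p mono[OF sub(1)] p_eq by auto
      have "\<tau> (k + 1) \<in> {a..s}" using p p_eq by (auto simp: Q_def image_subset_iff)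
      then consider "\<tau> (k + 1) = s" | "\<tau> (k + 1) < s" by fastforce
      then obtain q where "q \<in> Q {a..t}" "S p + W1 (\<nu> s) (\<nu> t) \<le> S q"
      proof cases
        case 1
        with ext[OF Qt, of t] assms sub that show ?thesis by (auto simp: p_eq)
      next
        case 2
        \<comment> \<open>The partition stops short of \<open>s\<close>, so \<open>s\<close> is
          inserted before \<open>t\<close>; the extra term only enlarges the sum.\<close>
        note e1 = ext[OF Qt 2 sub(2)]
        have "S (k + 1 + 1, (\<tau>(k + 2 := s))(k + 1 + 2 := t)) = S (k, \<tau>) + W1 (\<nu> (\<tau> (k + 1))) (\<nu> s) + W1 (\<nu> s) (\<nu> t)"
          "(k + 1 + 1, (\<tau>(k + 2 := s))(k + 1 + 2 := t)) \<in> Q {a..t}"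
          using ext[OF conjunct1[OF e1], of t] e1 assms sub by auto
        then show ?thesis by (intro that) (auto simp: p_eq add.assoc intro!: add_left_mono)
      qed
      then show "S p + W1 (\<nu> s) (\<nu> t) \<le> variation {a..t} \<nu>"
        unfolding var by (meson SUP_upper order_trans)
    qed
    finally show ?thesis .
  qed
qed

section \<open>Carrying differentiability over to the right-continuous representative\<close>

lemma AE_lebesgue_dense:
  assumes "AE x in lebesgue. P x" "a < (b :: real)"
  shows "\<exists>x. a < x \<and> x < b \<and> P x"
proof (rule ccontr)
  assume no: "\<not> ?thesis"
  obtain N where N: "N \<in> null_sets lebesgue" "{x. \<not> P x} \<subseteq> N"
    using assms(1) by (auto simp: eventually_ae_filter)
  then have "emeasure lebesgue {a<..<b} \<le> emeasure lebesgue N"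
    using no by (intro emeasure_mono) auto
  then show False using N(1) \<open>a < b\<close> by (auto simp: null_sets_def)
qed

text \<open>The values of \<open>f\<close> on the exceptional null set are limits from the right of values of \<open>g\<close>,
  and the estimate defining the derivative is closed under such limits.\<close>

lemma has_real_derivative_of_AE_eq:
  fixes f g :: "real \<Rightarrow> real"
  assumes g: "(g has_real_derivative D) (at t)" and t: "t \<in> {a<..<b}" "f t = g t"
    and ae: "AE s in lebesgue. s \<in> {a..b} \<longrightarrow> f s = g s"
    and cont: "\<And>s. s \<in> {a<..<b} \<Longrightarrow> (f \<longlongrightarrow> f s) (at_right s)"
  shows "(f has_real_derivative D) (at t)"
proof -
  have "\<exists>d>0. \<forall>s. \<bar>s - t\<bar> < d \<longrightarrow> \<bar>f s - f t - D * (s - t)\<bar> \<le> e * \<bar>s - t\<bar>" if "0 < e" for e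
  proof -
    obtain d0 where d0: "0 < d0" "\<And>s. \<bar>s - t\<bar> < d0 \<Longrightarrow> \<bar>g s - g t - D * (s - t)\<bar> \<le> e * \<bar>s - t\<bar>"
      using g \<open>0 < e\<close> unfolding has_field_derivative_def has_derivative_within_alt by auto
    define d where "d = min d0 (min (t - a) (b - t))"
    have d: "0 < d" "d \<le> d0" "d \<le> t - a" "d \<le> b - t"
      using d0(1) t(1) unfolding d_def by auto
    have "\<bar>f s - f t - D * (s - t)\<bar> \<le> e * \<bar>s - t\<bar>" if s: "\<bar>s - t\<bar> < d" for s
    proof (rule ccontr)
      let ?p = "\<lambda>s. \<bar>f s - f t - D * (s - t)\<bar> - e * \<bar>s - t\<bar>"
      assume "\<not> ?thesis"
      then have ps: "0 < ?p s" by simp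
      have "(?p \<longlongrightarrow> ?p s) (at_right s)"
        using s d by (intro tendsto_intros cont) auto
      from order_tendstoD(1)[OF this ps] have "\<forall>\<^sub>F y in at_right s. 0 < ?p y" .
      then obtain c where c: "s < c" "\<And>y. s < y \<Longrightarrow> y < c \<Longrightarrow> 0 < ?p y"
        unfolding eventually_at_right_field by blast
      have "s < min c (t + d)" using c s by auto
      from AE_lebesgue_dense[OF ae this] obtain y where
        y: "s < y" "y < min c (t + d)" "y \<in> {a..b} \<longrightarrow> f y = g y" by blast
      have "\<bar>y - t\<bar> < d" using s y(1,2) by linarith
      moreover from this have "f y = g y" using y(3) d by auto
      ultimately have "?p y \<le> 0" using d0(2)[of y] d(2) t(2) by simp
      moreover have "0 < ?p y" using y(1,2) by (intro c(2)) auto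
      ultimately show False by simp
    qed
    with d(1) show ?thesis by (intro exI[of _ d] conjI allI impI)
  qed
  then show ?thesis
    unfolding has_field_derivative_def has_derivative_within_alt
    by (auto simp: bounded_linear_mult_right)
qed

context
  assumes discrete: "\<And>S :: 'a::metric_space set. open S"
begin

text \<open>Bounded variation is available only for an almost everywhere equal curve \<nu>. Its atom
  \<open>g\<close> is handled by monotone functions, and the atom \<open>f\<close> of \<mu> inherits
  the derivative because it is right-continuous and agrees with \<open>g\<close> almost
  everywhere.\<close>

lemma BV_atom_differentiable_AE:
  fixes \<mu> :: "real \<Rightarrow> 'a measure"
  assumes "\<mu> \<in> BV_curves {0..1}"
  shows "AE t in lebesgue. t \<in> {0<..<1} \<longrightarrow> (\<exists>D. ((\<lambda>s. measure (\<mu> s) {x}) has_real_derivative D) (at t))"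
proof -
  \<comment> \<open>As \<open>{x}\<close> is open, a ball around \<open>x\<close> contains no other
    point; its radius bounds from below the cost of moving a unit of mass into or out of
    \<open>x\<close>.\<close>
  obtain r where r: "0 < r" "\<And>y. y \<noteq> x \<Longrightarrow> r \<le> dist x y"
  proof -
    have "\<exists>e>0. \<forall>y. dist y x < e \<longrightarrow> y \<in> {x}" using discrete[of "{x}"] by (simp add: open_dist)
    then show ?thesis using that by (metis dist_commute not_le_imp_less singletonD)
  qed
  have atom: "ennreal (r * \<bar>measure M {x} - measure N {x}\<bar>) \<le> W1 M N" for M N :: "'a measure"
    using r by (intro atom_diff_le_W1[OF discrete]) auto
  have "ess_variation {0..1} \<mu> < \<infinity>" using assms by (simp add: BV_curves_def)
  then obtain \<nu> where ae: "AE t\<in>{0..1} in lebesgue. \<nu> t = \<mu> t" and fin: "variation {0..1} \<nu> < \<infinity>"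
    unfolding ess_variation_def by (auto simp: INF_less_iff)
  define f where "f = (\<lambda>s. measure (\<mu> s) {x})"
  define g where "g = (\<lambda>s. measure (\<nu> s) {x})"
  define T where "T = (\<lambda>s. enn2real (variation {0..s} \<nu>))"
  have T0: "0 \<le> T s" for s by (simp add: T_def)
  have inc: "r * \<bar>g t - g s\<bar> \<le> T t - T s" if "0 \<le> s" "s < t" "t \<le> 1" for s t
  proof -
    have v: "variation {0..s} \<nu> + W1 (\<nu> s) (\<nu> t) \<le> variation {0..t} \<nu>"
      using that by (intro variation_add_le)
    have "variation {0..t} \<nu> < \<infinity>"
    proof (cases "t = 1")
      case False
      have "variation {0..t} \<nu> \<le> variation {0..t} \<nu> + W1 (\<nu> t) (\<nu> 1)" by simp
      also have "\<dots> \<le> variation {0..1} \<nu>" using that False by (intro variation_add_le) auto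
      finally show ?thesis using fin by (rule le_less_trans)
    qed (use fin in simp)
    then have t: "variation {0..t} \<nu> = ennreal (T t)" by (simp add: T_def)
    have "variation {0..s} \<nu> \<le> variation {0..s} \<nu> + W1 (\<nu> s) (\<nu> t)" by simp
    also note v
    also have "variation {0..t} \<nu> < \<infinity>" by (simp add: t)
    finally have "variation {0..s} \<nu> < \<infinity>" .
    then have s: "variation {0..s} \<nu> = ennreal (T s)" by (simp add: T_def)
    have "ennreal (T s + r * \<bar>g s - g t\<bar>) = variation {0..s} \<nu> + ennreal (r * \<bar>g s - g t\<bar>)"
      using r(1) T0[of s] by (simp add: s)
    also have "\<dots> \<le> variation {0..s} \<nu> + W1 (\<nu> s) (\<nu> t)"
      using atom[of "\<nu> s" "\<nu> t"] by (intro add_left_mono) (simp add: g_def)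
    also note v
    finally have "T s + r * \<bar>g s - g t\<bar> \<le> T t" unfolding t using T0[of t] by simp
    then show ?thesis by (simp add: abs_minus_commute)
  qed
  have inc': "\<bar>r * g t - r * g s\<bar> \<le> T t - T s" if "0 \<le> s" "s \<le> t" "t \<le> 1" for s t
    using inc[of s t] that r(1) by (cases "s = t") (auto simp: right_diff_distrib[symmetric] abs_mult)
  \<comment> \<open>The function \<open>r * g\<close> varies by no more than \<open>T\<close>
    increases, so adding it to \<open>T\<close> or subtracting it leaves a monotone function. Their
    difference is \<open>2 * r * g\<close>.\<close>
  have "mono_on {0..1} (\<lambda>s. T s + r * g s)" "mono_on {0..1} (\<lambda>s. T s - r * g s)"
  proof -
    have "T s + r * g s \<le> T t + r * g t \<and> T s - r * g s \<le> T t - r * g t"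
      if "s \<in> {0..1}" "t \<in> {0..1}" "s \<le> t" for s t
      using inc'[of s t] that by (auto simp: abs_le_iff)
    then show "mono_on {0..1} (\<lambda>s. T s + r * g s)" "mono_on {0..1} (\<lambda>s. T s - r * g s)"
      by (auto simp: mono_on_def)
  qed
  from this[THEN mono_on_differentiable_AE] ae
  have "AE t in lebesgue. t \<in> {0<..<1} \<longrightarrow> g differentiable (at t) \<and> f t = g t"
  proof eventually_elim
    case (elim t)
    show ?case
    proof
      assume t: "t \<in> {0<..<1}"
      then have "(\<lambda>s. ((T s + r * g s) - (T s - r * g s)) * (1 / (2 * r))) differentiable (at t)"
        using elim by (intro differentiable_mult differentiable_const)
          (rule differentiable_diff; auto)
      moreover have "(\<lambda>s. ((T s + r * g s) - (T s - r * g s)) * (1 / (2 * r))) = g"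
        using r(1) by (auto simp: field_simps)
      ultimately show "g differentiable (at t) \<and> f t = g t"
        using elim t by (simp add: f_def g_def)
    qed
  qed
  then show ?thesis
  proof eventually_elim
    case (elim t)
    show ?case
    proof
      assume t: "t \<in> {0<..<1}"
      then obtain D where D: "(g has_real_derivative D) (at t)" using elim by (auto simp: real_differentiable_def)
      have "(f has_real_derivative D) (at t)"
      proof (rule has_real_derivative_of_AE_eq[OF D t])
        show "f t = g t" using elim t by blast
        show "AE s in lebesgue. s \<in> {0..1} \<longrightarrow> f s = g s"
          using ae by eventually_elim (auto simp: f_def g_def)
        fix s :: real assume s: "s \<in> {0<..<1}"
        have "((\<lambda>u. W1 (\<mu> u) (\<mu> s)) \<longlongrightarrow> 0) (at s within {0..1} \<inter> {s<..})"
          using assms s by (auto simp: BV_curves_def cadlag_on_def)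
        moreover have "at s within {0..1} \<inter> {s<..} = at_right s"
          using s by (intro at_within_nhd[of s "{0<..<1}"]) auto
        ultimately have "((\<lambda>u. W1 (\<mu> u) (\<mu> s)) \<longlongrightarrow> 0) (at_right s)" by simp
        \<comment> \<open>Smallness in \<open>W1\<close> controls each atom, so right-continuity of
          the curve gives right-continuity of \<open>f\<close>.\<close>
        then have "((\<lambda>u. ennreal (r * \<bar>f u - f s\<bar>)) \<longlongrightarrow> 0) (at_right s)"
        proof (rule tendsto_sandwich[OF _ _ tendsto_const, rotated 2])
          show "\<forall>\<^sub>F u in at_right s. ennreal (r * \<bar>f u - f s\<bar>) \<le> W1 (\<mu> u) (\<mu> s)"
            unfolding f_def by (intro always_eventually allI atom)
        qed simp
        then have "((\<lambda>u. enn2real (ennreal (r * \<bar>f u - f s\<bar>)) / r) \<longlongrightarrow> enn2real 0 / r) (at_right s)"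
          using r(1) by (intro tendsto_divide tendsto_const tendsto_enn2real) simp_all
        moreover have "(\<lambda>u. enn2real (ennreal (r * \<bar>f u - f s\<bar>)) / r) = (\<lambda>u. \<bar>f u - f s\<bar>)"
          using r(1) by (intro ext) simp
        ultimately have "((\<lambda>u. f u - f s) \<longlongrightarrow> 0) (at_right s)"
          by (simp only: enn2real_0 div_0 tendsto_rabs_zero_cancel)
        then show "(f \<longlongrightarrow> f s) (at_right s)" by (simp add: LIM_zero_iff)
      qed
      then show "\<exists>D. ((\<lambda>s. measure (\<mu> s) {x}) has_real_derivative D) (at t)" by (auto simp: f_def)
    qed
  qed
qed

end

section \<open>Currents\<close>

lemma infsum_eq_sum_support:
  fixes f :: "'b \<Rightarrow> ennreal"
  assumes "finite F" "\<And>x. x \<notin> F \<Longrightarrow> f x = 0"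
  shows "infsum f UNIV = sum f F"
proof -
  have "infsum f UNIV = infsum f F"
    using assms(2) by (intro infsum_cong_neutral) auto
  then show ?thesis using assms(1) by simp
qed

context
  assumes discrete: "\<And>S :: 'a::metric_space set. open S"
    and countable: "countable (UNIV :: 'a set)"
begin

text \<open>A current is a flow divided by the mass at its source, which is possible only if
  massless points emit nothing. There \<open>f\<close> is nonnegative by hypothesis, and the bound
  of entries by \<open>max 0 (- f x)\<close> makes their rows vanish.\<close>

lemma current_of_flow:
  fixes M :: "'a measure"
  assumes M: "M \<in> prob_measures" and F: "finite F" "F \<noteq> {}"
    and f: "(\<Sum>x\<in>F. f x) = 0" "\<And>x. x \<notin> F \<Longrightarrow> f x = 0"
    and nonneg: "\<And>x. measure M {x} = 0 \<Longrightarrow> 0 \<le> f x"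
  shows "\<exists>w. (\<forall>x. w x \<in> positive_measures) \<and>
    (\<forall>x. inflow M w x < \<infinity> \<and> outflow M w x < \<infinity> \<and> f x = enn2real (inflow M w x) - enn2real (outflow M w x)) \<and>
    current_cost M w = ennreal (beckmann F f)"
proof -
  interpret prob_space M using M by (simp add: prob_measures_def)
  obtain c where c: "flow F f c" "flow_cost distance F c = beckmann F f"
    and tight: "\<And>x y. x \<in> F \<Longrightarrow> y \<in> F \<Longrightarrow> c (x, y) \<le> max 0 (- f x) \<and> c (x, y) \<le> max 0 (f y)"
    by (rule beckmann_attained[OF F f(1)]) (rule that)
  have c0: "0 \<le> c z" if "z \<in> F \<times> F" for z using c(1) that unfolding flow_def by blast
  have div: "(\<Sum>y\<in>F. c (y, x)) - (\<Sum>y\<in>F. c (x, y)) = f x" if "x \<in> F" for x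
    using c(1) that unfolding flow_def by blast
  define C where "C = (\<lambda>z. if z \<in> F \<times> F then c z else 0)"
  have C0: "0 \<le> C z" for z using c0[of z] by (simp add: C_def)
  have Cz: "C z = 0" if "z \<notin> F \<times> F" for z using that by (simp add: C_def)
  \<comment> \<open>At a massless \<open>x\<close> the quotient is 0 by the convention for division;
    nothing is lost, since \<open>C\<close> vanishes on that row.\<close>
  define w where "w = (\<lambda>x. density (count_space UNIV) (\<lambda>y. ennreal (C (x, y) / measure M {x})))"
  have w: "emeasure (w x) {y} = ennreal (C (x, y) / measure M {x})" for x y
    by (simp add: w_def emeasure_density)
  have prod: "emeasure (w x) {y} * emeasure M {x} = ennreal (C (x, y))" for x y
  proof (cases "measure M {x} = 0")
    case True
    have "C (x, y) = 0"
    proof (cases "(x, y) \<in> F \<times> F")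
      case True
      with tight[of x y] c0[of "(x, y)"] nonneg[OF \<open>measure M {x} = 0\<close>] show ?thesis
        by (auto simp: C_def)
    qed (rule Cz)
    then show ?thesis by (simp add: w)
  next
    case False
    then have "0 < measure M {x}" by (simp add: less_le)
    then show ?thesis unfolding w emeasure_eq_measure using C0
      by (subst ennreal_mult[symmetric]) auto
  qed
  have inflow: "inflow M w x = ennreal (\<Sum>y\<in>F. C (y, x))" for x
    unfolding inflow_def prod
    using F(1) C0 by (subst infsum_eq_sum_support[OF F(1)]) (auto simp: Cz)
  have outflow: "outflow M w x = ennreal (\<Sum>y\<in>F. C (x, y))" for x
  proof -
    have "outflow M w x = emeasure M {x} * (\<Sum>y\<in>F. emeasure (w x) {y})"
      unfolding outflow_def by (subst infsum_eq_sum_support[OF F(1)]) (auto simp: w Cz)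
    also have "\<dots> = (\<Sum>y\<in>F. ennreal (C (x, y)))"
      unfolding sum_distrib_left prod[symmetric] by (simp add: mult.commute)
    finally show ?thesis using C0 by simp
  qed
  have net: "(\<Sum>y\<in>F. C (y, x)) - (\<Sum>y\<in>F. C (x, y)) = f x" for x
  proof (cases "x \<in> F")
    case True
    then show ?thesis using div[OF True] by (simp add: C_def)
  qed (use f(2) in \<open>simp add: Cz\<close>)
  have cost: "current_cost M w = ennreal (beckmann F f)"
  proof -
    have "current_cost M w = (\<Sum>\<^sub>\<infinity>z. ennreal (distance z) * ennreal (C z))"
      unfolding current_cost_def by (simp add: case_prod_unfold mult.assoc prod)
    also have "\<dots> = (\<Sum>z\<in>F \<times> F. ennreal (distance z) * ennreal (C z))"
      using F(1) by (intro infsum_eq_sum_support) (auto simp: Cz)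
    also have "\<dots> = (\<Sum>z\<in>F \<times> F. ennreal (distance z * C z))"
      using C0 by (intro sum.cong refl ennreal_mult[symmetric]) (auto simp: case_prod_unfold)
    also have "\<dots> = ennreal (\<Sum>z\<in>F \<times> F. distance z * C z)"
      using C0 by (intro sum_ennreal) (auto simp: case_prod_unfold)
    also have "(\<Sum>z\<in>F \<times> F. distance z * C z) = flow_cost distance F c"
      unfolding flow_cost_def by (intro sum.cong) (auto simp: C_def)
    finally show ?thesis using c(2) by simp
  qed
  have "w x \<in> positive_measures" for x
    using sets_borel_discrete[OF discrete] by (simp add: w_def positive_measures_def)
  moreover have "inflow M w x < \<infinity> \<and> outflow M w x < \<infinity> \<and> f x = enn2real (inflow M w x) - enn2real (outflow M w x)" for x
    unfolding inflow outflow using net[of x] C0 by (simp add: sum_nonneg)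
  ultimately show ?thesis using cost by (intro exI[of _ w]) simp
qed

text \<open>Multiplied by the source mass, a current is a flow once it is known to stay within
  \<open>F\<close>. Outside \<open>F\<close> there is no mass, hence no outflow, and the net rate is
  zero, so the inflow vanishes as well.\<close>

lemma beckmann_le_current_cost:
  fixes M :: "'a measure"
  assumes M: "M \<in> prob_measures" "\<And>x. x \<notin> F \<Longrightarrow> measure M {x} = 0" and F: "finite F"
    and fin: "\<And>x. inflow M w x < \<infinity>" "\<And>x. outflow M w x < \<infinity>"
    and f: "\<And>x. f x = enn2real (inflow M w x) - enn2real (outflow M w x)"
    and f0: "\<And>x. x \<notin> F \<Longrightarrow> f x = 0"
  shows "ennreal (beckmann F f) \<le> current_cost M w"
proof -
  interpret prob_space M using M by (simp add: prob_measures_def)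
  define a where "a = (\<lambda>(x, y). emeasure (w x) {y} * emeasure M {x})"
  have a1: "a (x, y) = 0" if "x \<notin> F" for x y
    using M(2)[OF that] by (simp add: a_def emeasure_eq_measure)
  have inflow: "inflow M w x = (\<Sum>y\<in>F. a (y, x))" for x
    unfolding inflow_def by (subst infsum_eq_sum_support[OF F]) (use a1 in \<open>auto simp: a_def\<close>)
  have a2: "a (x, y) = 0" if "y \<notin> F" for x y
  proof -
    have "outflow M w y = 0" using M(2)[OF that] by (simp add: outflow_def emeasure_eq_measure)
    then have "enn2real (inflow M w y) = 0" using f[of y] f0[OF that] by simp
    then have "inflow M w y = 0" using fin(1)[of y] by (auto simp: enn2real_eq_0_iff)
    then have "\<forall>x\<in>F. a (x, y) = 0" unfolding inflow using F by simp
    then show ?thesis using a1 by blast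
  qed
  have outflow: "outflow M w x = (\<Sum>y\<in>F. a (x, y))" for x
  proof (cases "measure M {x} = 0")
    case True
    \<comment> \<open>The total mass of \<open>w x\<close> may be infinite here; the convention
      \<open>0 * \<infinity> = 0\<close> makes both sides vanish.\<close>
    then show ?thesis by (simp add: outflow_def a_def emeasure_eq_measure)
  next
    case False
    then have "emeasure (w x) {y} = 0" if "y \<notin> F" for y
      using a2[OF that, of x] by (simp add: a_def emeasure_eq_measure)
    then have "(\<Sum>\<^sub>\<infinity>y. emeasure (w x) {y}) = (\<Sum>y\<in>F. emeasure (w x) {y})"
      by (intro infsum_eq_sum_support[OF F])
    then show ?thesis by (simp add: outflow_def a_def sum_distrib_left mult.commute)
  qed
  have afin: "a z < \<infinity>" if "z \<in> F \<times> F" for z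
  proof -
    obtain x y where z: "z = (x, y)" "x \<in> F" "y \<in> F" using \<open>z \<in> F \<times> F\<close> by auto
    have "a z \<le> inflow M w y" unfolding inflow z(1) using z(2) F by (intro member_le_sum) auto
    then show ?thesis using fin(1)[of y] by (rule le_less_trans)
  qed
  define c where "c = (\<lambda>z. enn2real (a z))"
  have ca: "ennreal (c z) = a z" if "z \<in> F \<times> F" for z
    using afin[OF that] by (simp add: c_def)
  have "flow F f c"
    unfolding flow_def
  proof (intro conjI ballI)
    fix x assume x: "x \<in> F"
    have "inflow M w x = (\<Sum>y\<in>F. ennreal (c (y, x)))" "outflow M w x = (\<Sum>y\<in>F. ennreal (c (x, y)))"
      unfolding inflow outflow using x by (auto intro!: sum.cong simp: ca)
    then have "enn2real (inflow M w x) = (\<Sum>y\<in>F. c (y, x))" "enn2real (outflow M w x) = (\<Sum>y\<in>F. c (x, y))"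
      by (simp_all add: c_def sum_nonneg)
    then show "(\<Sum>y\<in>F. c (y, x)) - (\<Sum>y\<in>F. c (x, y)) = f x" by (simp add: f)
  qed (simp add: c_def)
  then have "ennreal (beckmann F f) \<le> ennreal (flow_cost distance F c)"
    by (intro ennreal_leI beckmann_le)
  also have "\<dots> = (\<Sum>z\<in>F \<times> F. ennreal (distance z * c z))"
    unfolding flow_cost_def by (intro sum_ennreal[symmetric]) (auto simp: c_def case_prod_unfold)
  also have "\<dots> = (\<Sum>z\<in>F \<times> F. ennreal (distance z) * a z)"
  proof (intro sum.cong refl)
    fix z assume "z \<in> F \<times> F"
    have "ennreal (distance z * c z) = ennreal (distance z) * ennreal (c z)"
      by (intro ennreal_mult) (auto simp: c_def case_prod_unfold)
    then show "ennreal (distance z * c z) = ennreal (distance z) * a z"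
      using ca[OF \<open>z \<in> F \<times> F\<close>] by simp
  qed
  also have "\<dots> = (\<Sum>\<^sub>\<infinity>z. ennreal (distance z) * a z)"
    using F a1 a2 by (intro infsum_eq_sum_support[symmetric]) auto
  also have "\<dots> = current_cost M w"
    unfolding current_cost_def by (simp add: case_prod_unfold mult.assoc a_def)
  finally show ?thesis .
qed

text \<open>An atom outside the support is at its minimum, and the total mass of the support is at its
  maximum, so both derivatives vanish.\<close>

lemma atom_derivative_constraints:
  fixes \<mu> :: "real \<Rightarrow> 'a measure"
  assumes \<mu>: "\<And>s. s \<in> {0..1} \<Longrightarrow> \<mu> s \<in> prob_measures" and t: "t \<in> {0<..<1}"
    and D: "\<And>x. ((\<lambda>s. measure (\<mu> s) {x}) has_real_derivative f x) (at t)"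
  shows "measure (\<mu> t) {x} = 0 \<Longrightarrow> f x = 0"
    and "finite F \<Longrightarrow> (\<And>x. x \<notin> F \<Longrightarrow> measure (\<mu> t) {x} = 0) \<Longrightarrow> (\<Sum>x\<in>F. f x) = 0"
proof -
  show "f x = 0" if "measure (\<mu> t) {x} = 0"
    using that by (intro DERIV_local_min[OF D, of 1]) auto
  show "(\<Sum>x\<in>F. f x) = 0" if F: "finite F" "\<And>x. x \<notin> F \<Longrightarrow> measure (\<mu> t) {x} = 0"
  proof (rule DERIV_local_max)
    show "((\<lambda>s. \<Sum>x\<in>F. measure (\<mu> s) {x}) has_real_derivative (\<Sum>x\<in>F. f x)) (at t)"
      by (intro DERIV_sum D)
    \<comment> \<open>This radius keeps the competing times in the unit interval, where the curve is
      known to consist of probability measures.\<close>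
    show "0 < min t (1 - t)" using t by auto
    have "(\<Sum>x\<in>F. measure (\<mu> s) {x}) \<le> 1" if "s \<in> {0..1}" for s
    proof -
      interpret prob_space "\<mu> s" using \<mu>[OF that] by (simp add: prob_measures_def)
      have "A \<in> sets (\<mu> s)" for A using \<mu>[OF that] sets_discrete[OF discrete] by (auto simp: prob_measures_def)
      then have "(\<Sum>x\<in>F. measure (\<mu> s) {x}) = measure (\<mu> s) F"
        using F(1) by (intro finite_measure_eq_sum_singleton[symmetric]) auto
      then show ?thesis by simp
    qed
    moreover have "(\<Sum>x\<in>F. measure (\<mu> t) {x}) = 1"
      using t F by (intro sum_measure_support[OF discrete countable] \<mu>) auto
    moreover have "y \<in> {0..1}" if "\<bar>t - y\<bar> < min t (1 - t)" for y
      using that by auto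
    ultimately show "\<forall>y. \<bar>t - y\<bar> < min t (1 - t) \<longrightarrow>
        (\<Sum>x\<in>F. measure (\<mu> y) {x}) \<le> (\<Sum>x\<in>F. measure (\<mu> t) {x})"
      by presburger
  qed
qed

text \<open>On a finite \<open>B\<close> carrying the measures at all times, the quotient of
  \<open>W1\<close> by the absolute value of \<open>h\<close> is exactly the minimal cost for the
  difference quotients of the atoms, to which continuity of that cost applies. A set carrying only
  \<open>\<mu> t\<close> would not do, because \<open>\<mu> (t + h)\<close> must be supported there
  too.\<close>

lemma metric_derivative_eq_beckmann:
  fixes \<mu> :: "real \<Rightarrow> 'a measure"
  assumes \<mu>: "\<And>s. s \<in> {0..1} \<Longrightarrow> \<mu> s \<in> prob_measures" and t: "t \<in> {0<..<1}"
    and D: "\<And>x. ((\<lambda>s. measure (\<mu> s) {x}) has_real_derivative f x) (at t)"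
    and B: "finite B" "\<And>s x. s \<in> {0..1} \<Longrightarrow> x \<notin> B \<Longrightarrow> measure (\<mu> s) {x} = 0"
  shows "has_metric_derivative \<mu> (beckmann B f) {0..1} t"
proof -
  have one: "(\<Sum>x\<in>B. measure (\<mu> s) {x}) = 1" if "s \<in> {0..1}" for s
    using that B by (intro sum_measure_support[OF discrete countable] \<mu>) auto
  then have "B \<noteq> {}" by force
  have f: "(\<Sum>x\<in>B. f x) = 0"
    using t B by (intro atom_derivative_constraints(2)[OF \<mu> t D]) auto
  let ?F = "at 0 within {h. t + h \<in> {0..1}}"
  define G where "G = (\<lambda>h x. (measure (\<mu> (t + h)) {x} - measure (\<mu> t) {x}) / h)"
  have ev: "\<forall>\<^sub>F h in ?F. h \<noteq> 0 \<and> t + h \<in> {0..1}"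
    by (auto simp: eventually_at_filter)
  have zero: "(\<Sum>x\<in>B. measure (\<mu> (t + h)) {x} - measure (\<mu> t) {x}) = 0" if "t + h \<in> {0..1}" for h
    using one[OF that] one[of t] t by (simp add: sum_subtractf)
  have "((\<lambda>h. beckmann B (G h)) \<longlongrightarrow> beckmann B f) ?F"
  proof (rule tendsto_beckmann[OF B(1) \<open>B \<noteq> {}\<close> _ f])
    show "((\<lambda>h. G h x) \<longlongrightarrow> f x) ?F" for x
      using D[of x] unfolding DERIV_def G_def by (rule tendsto_within_subset) simp
    show "\<forall>\<^sub>F h in ?F. (\<Sum>x\<in>B. G h x) = 0"
      using ev by eventually_elim (simp add: G_def sum_divide_distrib[symmetric] zero)
  qed
  moreover have "\<forall>\<^sub>F h in ?F. beckmann B (G h) = enn2real (W1 (\<mu> t) (\<mu> (t + h))) / \<bar>h\<bar>"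
    using ev
  proof eventually_elim
    case (elim h)
    have "W1 (\<mu> t) (\<mu> (t + h)) = ennreal (beckmann B (\<lambda>x. measure (\<mu> (t + h)) {x} - measure (\<mu> t) {x}))"
      using t elim B \<open>B \<noteq> {}\<close> by (intro W1_eq_beckmann[OF discrete countable] \<mu>) auto
    moreover have "0 \<le> beckmann B (\<lambda>x. measure (\<mu> (t + h)) {x} - measure (\<mu> t) {x})"
      using elim by (intro beckmann_nonneg[OF B(1) \<open>B \<noteq> {}\<close>] zero) auto
    moreover have "beckmann B (G h) = beckmann B (\<lambda>x. measure (\<mu> (t + h)) {x} - measure (\<mu> t) {x}) / \<bar>h\<bar>"
      unfolding G_def using elim by (intro beckmann_divide[OF B(1) \<open>B \<noteq> {}\<close>] zero) auto
    ultimately show ?case by simp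
  qed
  ultimately show ?thesis
    unfolding has_metric_derivative_def by (rule Lim_transform_eventually)
qed

text \<open>Countability of the space unites the exceptional null sets of all points into one, and
  dropping the two endpoints turns derivatives within the interval into two-sided ones. Later
  arguments can then work at one interior time with all atoms at hand.\<close>

lemma current_equation_iff:
  fixes \<mu> :: "real \<Rightarrow> 'a measure"
  shows "current_equation {0..1} \<mu> v \<longleftrightarrow>
    (\<forall>t\<in>{0..1}. \<mu> t \<in> prob_measures) \<and> (\<forall>t\<in>{0..1}. \<forall>x. v t x \<in> positive_measures) \<and>
    (AE t in lebesgue. t \<in> {0<..<1} \<longrightarrow> (\<forall>x.
        inflow (\<mu> t) (v t) x < \<infinity> \<and> outflow (\<mu> t) (v t) x < \<infinity> \<and>
        ((\<lambda>s. measure (\<mu> s) {x}) has_real_derivative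
           enn2real (inflow (\<mu> t) (v t) x) - enn2real (outflow (\<mu> t) (v t) x)) (at t)))"
proof -
  define P where "P = (\<lambda>t x S. inflow (\<mu> t) (v t) x < \<infinity> \<and> outflow (\<mu> t) (v t) x < \<infinity> \<and>
        ((\<lambda>s. measure (\<mu> s) {x}) has_real_derivative
           enn2real (inflow (\<mu> t) (v t) x) - enn2real (outflow (\<mu> t) (v t) x)) (at t within S))"
  have ends: "AE t in lebesgue. t \<noteq> 0 \<and> t \<noteq> (1::real)"
    by (rule AE_I'[of "{0, 1}"]) (auto simp: negligible_iff_null_sets[symmetric])
  have same: "at t within {0..1} = at t" if "t \<in> {0<..<1}" for t :: real
    using that by (intro at_within_Icc_at) auto
  have "(\<forall>x. AE t\<in>{0..1} in lebesgue. P t x {0..1}) \<longleftrightarrow> (AE t in lebesgue. \<forall>x\<in>UNIV. t \<in> {0..1} \<longrightarrow> P t x {0..1})"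
    by (subst AE_ball_countable[OF countable]) simp
  also have "\<dots> \<longleftrightarrow> (AE t in lebesgue. t \<in> {0<..<1} \<longrightarrow> (\<forall>x. P t x UNIV))"
  proof
    assume "AE t in lebesgue. \<forall>x\<in>UNIV. t \<in> {0..1} \<longrightarrow> P t x {0..1}"
    then show "AE t in lebesgue. t \<in> {0<..<1} \<longrightarrow> (\<forall>x. P t x UNIV)"
      by eventually_elim (auto simp: P_def same)
  next
    assume "AE t in lebesgue. t \<in> {0<..<1} \<longrightarrow> (\<forall>x. P t x UNIV)"
    with ends show "AE t in lebesgue. \<forall>x\<in>UNIV. t \<in> {0..1} \<longrightarrow> P t x {0..1}"
    proof eventually_elim
      case (elim t)
      then have "t \<in> {0..1} \<Longrightarrow> t \<in> {0<..<1}" by auto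
      with elim show ?case by (auto simp: P_def same)
    qed
  qed
  finally show ?thesis unfolding current_equation_def P_def by simp
qed

text \<open>The current equation constrains the currents at each time separately, so they are chosen
  time by time, from an optimal flow wherever all atoms are differentiable. The set
  \<open>F t\<close> may vary: the individual supports serve for existence, a constant set for the
  optimal cost.\<close>

lemma exists_optimal_current:
  fixes \<mu> :: "real \<Rightarrow> 'a measure"
  assumes BV: "\<mu> \<in> BV_curves {0..1}"
    and F: "\<And>t. t \<in> {0..1} \<Longrightarrow> finite (F t)" "\<And>t x. t \<in> {0..1} \<Longrightarrow> x \<notin> F t \<Longrightarrow> measure (\<mu> t) {x} = 0"
  shows "\<exists>v. current_equation {0..1} \<mu> v \<and>
    (AE t in lebesgue. t \<in> {0<..<1} \<longrightarrow> (\<exists>f. (\<forall>x. ((\<lambda>s. measure (\<mu> s) {x}) has_real_derivative f x) (at t)) \<and>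
      current_cost (\<mu> t) (v t) = ennreal (beckmann (F t) f)))"
proof -
  have \<mu>: "\<mu> s \<in> prob_measures" if "s \<in> {0..1}" for s
    using BV that by (auto simp: BV_curves_def P1_def)
  define A where "A = (\<lambda>t f w. (\<forall>x. w x \<in> positive_measures) \<and>
    (\<forall>x. inflow (\<mu> t) w x < \<infinity> \<and> outflow (\<mu> t) w x < \<infinity> \<and>
      f x = enn2real (inflow (\<mu> t) w x) - enn2real (outflow (\<mu> t) w x)) \<and>
    current_cost (\<mu> t) w = ennreal (beckmann (F t) f))"
  define good where "good = (\<lambda>t f. t \<in> {0<..<1::real} \<and>
    (\<forall>x. ((\<lambda>s. measure (\<mu> s) {x}) has_real_derivative f x) (at t)))"
  have ex: "\<exists>w. A t f w" if "good t f" for t f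
  proof -
    have t: "t \<in> {0<..<1}" "t \<in> {0..1}" and D: "\<And>x. ((\<lambda>s. measure (\<mu> s) {x}) has_real_derivative f x) (at t)"
      using that by (auto simp: good_def)
    note c = atom_derivative_constraints[OF \<mu> t(1) D]
    have "(\<Sum>x\<in>F t. measure (\<mu> t) {x}) = 1"
      using F t by (intro sum_measure_support[OF discrete countable] \<mu>) auto
    then have "F t \<noteq> {}" by force
    then show ?thesis
      unfolding A_def using F t c
      by (intro current_of_flow \<mu>) auto
  qed
  have "\<exists>w. (\<forall>x. w x \<in> positive_measures) \<and> ((\<exists>f. good t f) \<longrightarrow> (\<exists>f. good t f \<and> A t f w))" for t
  proof (cases "\<exists>f. good t f")
    case True
    with ex show ?thesis unfolding A_def by blast
  next
    case False
    \<comment> \<open>A default for the times at which some atom is not differentiable; inside the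
      interval they form a null set.\<close>
    then show ?thesis by (intro exI[of _ "\<lambda>_. borel"]) (auto simp: positive_measures_def)
  qed
  then obtain v where v: "\<And>t x. v t x \<in> positive_measures"
    "\<And>t. (\<exists>f. good t f) \<longrightarrow> (\<exists>f. good t f \<and> A t f (v t))"
    by metis
  have "AE t in lebesgue. \<forall>x\<in>UNIV. t \<in> {0<..<1} \<longrightarrow> (\<exists>D. ((\<lambda>s. measure (\<mu> s) {x}) has_real_derivative D) (at t))"
    using BV_atom_differentiable_AE[OF discrete BV] by (subst AE_ball_countable[OF countable]) auto
  then have AE: "AE t in lebesgue. t \<in> {0<..<1} \<longrightarrow> (\<exists>f. good t f \<and> A t f (v t))"
  proof eventually_elim
    case (elim t)
    show ?case
    proof
      assume t: "t \<in> {0<..<1}"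
      with elim have "\<forall>x. \<exists>D. ((\<lambda>s. measure (\<mu> s) {x}) has_real_derivative D) (at t)" by simp
      then have "\<exists>f. good t f" using t unfolding good_def by metis
      with v(2) show "\<exists>f. good t f \<and> A t f (v t)" by blast
    qed
  qed
  show ?thesis
  proof (intro exI[of _ v] conjI)
    show "current_equation {0..1} \<mu> v"
      unfolding current_equation_iff
    proof (intro conjI ballI allI \<mu> v(1))
      show "AE t in lebesgue. t \<in> {0<..<1} \<longrightarrow> (\<forall>x.
        inflow (\<mu> t) (v t) x < \<infinity> \<and> outflow (\<mu> t) (v t) x < \<infinity> \<and>
        ((\<lambda>s. measure (\<mu> s) {x}) has_real_derivative
           enn2real (inflow (\<mu> t) (v t) x) - enn2real (outflow (\<mu> t) (v t) x)) (at t))"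
        using AE by eventually_elim (auto simp: good_def A_def)
    qed auto
    show "AE t in lebesgue. t \<in> {0<..<1} \<longrightarrow>
        (\<exists>f. (\<forall>x. ((\<lambda>s. measure (\<mu> s) {x}) has_real_derivative f x) (at t)) \<and>
          current_cost (\<mu> t) (v t) = ennreal (beckmann (F t) f))"
      using AE by eventually_elim (auto simp: good_def A_def)
  qed
qed

section \<open>Supports in a proper discrete space\<close>

lemma measure_outside_supp:
  fixes M :: "'a measure"
  assumes "M \<in> prob_measures" "x \<notin> supp M"
  shows "measure M {x} = 0"
proof -
  obtain U where U: "x \<in> U" "emeasure M U = 0" using assms(2) by (auto simp: supp_def)
  have "emeasure M {x} \<le> emeasure M U"
    using U assms(1) sets_discrete[OF discrete] by (intro emeasure_mono) (auto simp: prob_measures_def)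
  then show ?thesis using U by (simp add: measure_def)
qed

text \<open>Every set is closed in a discrete space, so properness makes a bounded set compact, and
  its cover by open singletons has a finite subcover.\<close>

lemma finite_of_bounded:
  assumes proper: "\<And>S :: 'a set. closed S \<Longrightarrow> bounded S \<Longrightarrow> compact S" and "bounded (S :: 'a set)"
  shows "finite S"
proof -
  have "closed S" using discrete[of "- S"] by (simp add: closed_def)
  then have "compact S" using proper \<open>bounded S\<close> by blast
  moreover have "S \<subseteq> (\<Union>x\<in>S. {x})" by auto
  ultimately obtain C where "C \<subseteq> S" "finite C" "S \<subseteq> (\<Union>x\<in>C. {x})"
    using discrete by (metis compactE_image)
  then show ?thesis by (metis UN_singleton finite_subset)
qed

end

theorem theorem4p10:
  fixes \<mu> :: "real \<Rightarrow> 'a::metric_space measure" and I :: "real set"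
  assumes countable: "countable (UNIV :: 'a set)"
    and proper: "\<And>S :: 'a set. closed S \<Longrightarrow> bounded S \<Longrightarrow> compact S"
    and discrete: "\<And>S :: 'a set. open S"
    and I_def: "I = {0..1}"
    and BV: "\<mu> \<in> BV_curves I"
    and supp_bounded: "\<And>t. t \<in> I \<Longrightarrow> bounded (supp (\<mu> t))"
  shows "(\<exists>v. current_equation I \<mu> v) \<and>
    ((\<exists>B. bounded B \<and> (\<forall>t\<in>I. supp (\<mu> t) \<subseteq> B)) \<longrightarrow>
      (\<forall>v. current_equation I \<mu> v \<longrightarrow>
        (AE t\<in>I in lebesgue. \<exists>m. has_metric_derivative \<mu> m I t \<and>
           ennreal m \<le> current_cost (\<mu> t) (v t))) \<and>
      (\<exists>v. current_equation I \<mu> v \<and>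
        (AE t\<in>I in lebesgue. \<exists>m. has_metric_derivative \<mu> m I t \<and>
           ennreal m = current_cost (\<mu> t) (v t))))"
  unfolding I_def
proof (intro conjI impI allI)
  have BV: "\<mu> \<in> BV_curves {0..1}" using BV I_def by simp
  then have \<mu>: "\<mu> s \<in> prob_measures" if "s \<in> {0..1}" for s
    using that by (auto simp: BV_curves_def P1_def)
  have "finite (supp (\<mu> t))" if "t \<in> {0..1}" for t
    using that I_def by (intro finite_of_bounded[OF discrete countable proper] supp_bounded) auto
  moreover have "measure (\<mu> t) {x} = 0" if "t \<in> {0..1}" "x \<notin> supp (\<mu> t)" for t x
    using that by (intro measure_outside_supp[OF discrete countable \<mu>])
  ultimately have "\<exists>v. current_equation {0..1} \<mu> v \<and> (AE t in lebesgue. t \<in> {0<..<1} \<longrightarrow>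
      (\<exists>f. (\<forall>x. ((\<lambda>s. measure (\<mu> s) {x}) has_real_derivative f x) (at t)) \<and>
        current_cost (\<mu> t) (v t) = ennreal (beckmann (supp (\<mu> t)) f)))"
    by (rule exists_optimal_current[OF discrete countable BV])
  then show "\<exists>v. current_equation {0..1} \<mu> v" by blast
  have AE_closed: "AE t\<in>{0..1} in lebesgue. P t" if "AE t in lebesgue. t \<in> {0<..<1} \<longrightarrow> P t" for P :: "real \<Rightarrow> bool"
  proof -
    have "AE t in lebesgue. t \<noteq> 0 \<and> t \<noteq> (1::real)"
      by (rule AE_I'[of "{0, 1}"]) (auto simp: negligible_iff_null_sets[symmetric])
    with that show ?thesis by eventually_elim auto
  qed
  assume "\<exists>B. bounded B \<and> (\<forall>t\<in>{0..1}. supp (\<mu> t) \<subseteq> B)"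
  then obtain B where "bounded B" and supp: "\<And>t. t \<in> {0..1} \<Longrightarrow> supp (\<mu> t) \<subseteq> B" by blast
  then have B: "finite B" using finite_of_bounded[OF discrete countable proper] by blast
  have B0: "measure (\<mu> s) {x} = 0" if "s \<in> {0..1}" "x \<notin> B" for s x
    using that supp measure_outside_supp[OF discrete countable \<mu>] by blast
  have md: "has_metric_derivative \<mu> (beckmann B f) {0..1} t"
    if "t \<in> {0<..<1}" "\<forall>x. ((\<lambda>s. measure (\<mu> s) {x}) has_real_derivative f x) (at t)" for t f
    using that by (intro metric_derivative_eq_beckmann[OF discrete countable \<mu> _ _ B B0]) auto
  show "\<exists>v. current_equation {0..1} \<mu> v \<and>
      (AE t\<in>{0..1} in lebesgue. \<exists>m. has_metric_derivative \<mu> m {0..1} t \<and> ennreal m = current_cost (\<mu> t) (v t))"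
  proof -
    \<comment> \<open>The current is built anew on the fixed set \<open>B\<close> instead of the
      single supports, so that its cost is literally the number \<open>beckmann B f\<close> found as
      the metric derivative; flows confined to a smaller set might a priori be dearer.\<close>
    have "\<exists>v. current_equation {0..1} \<mu> v \<and> (AE t in lebesgue. t \<in> {0<..<1} \<longrightarrow>
        (\<exists>f. (\<forall>x. ((\<lambda>s. measure (\<mu> s) {x}) has_real_derivative f x) (at t)) \<and>
          current_cost (\<mu> t) (v t) = ennreal (beckmann B f)))"
      by (rule exists_optimal_current[OF discrete countable BV B B0])
    then obtain v where v: "current_equation {0..1} \<mu> v"
      "AE t in lebesgue. t \<in> {0<..<1} \<longrightarrow> (\<exists>f. (\<forall>x. ((\<lambda>s. measure (\<mu> s) {x}) has_real_derivative f x) (at t)) \<and>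
        current_cost (\<mu> t) (v t) = ennreal (beckmann B f))"
      by (elim exE conjE)
    from v(2) have "AE t in lebesgue. t \<in> {0<..<1} \<longrightarrow>
        (\<exists>m. has_metric_derivative \<mu> m {0..1} t \<and> ennreal m = current_cost (\<mu> t) (v t))"
    proof eventually_elim
      case (elim t)
      show ?case
      proof
        assume t: "t \<in> {0<..<1}"
        with elim obtain f where f: "\<forall>x. ((\<lambda>s. measure (\<mu> s) {x}) has_real_derivative f x) (at t)"
          "current_cost (\<mu> t) (v t) = ennreal (beckmann B f)" by blast
        show "\<exists>m. has_metric_derivative \<mu> m {0..1} t \<and> ennreal m = current_cost (\<mu> t) (v t)"
          by (intro exI[of _ "beckmann B f"] conjI md[OF t f(1)] f(2)[symmetric])
      qed
    qed
    then show ?thesis by (intro exI[of _ v] conjI v(1) AE_closed)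
  qed
  fix v assume "current_equation {0..1} \<mu> v"
  then have "AE t in lebesgue. t \<in> {0<..<1} \<longrightarrow> (\<forall>x.
        inflow (\<mu> t) (v t) x < \<infinity> \<and> outflow (\<mu> t) (v t) x < \<infinity> \<and>
        ((\<lambda>s. measure (\<mu> s) {x}) has_real_derivative
           enn2real (inflow (\<mu> t) (v t) x) - enn2real (outflow (\<mu> t) (v t) x)) (at t))"
    unfolding current_equation_iff[OF discrete countable] by blast
  then have "AE t in lebesgue. t \<in> {0<..<1} \<longrightarrow>
      (\<exists>m. has_metric_derivative \<mu> m {0..1} t \<and> ennreal m \<le> current_cost (\<mu> t) (v t))"
  proof eventually_elim
    case (elim t)
    show ?case
    proof
      assume t: "t \<in> {0<..<1}"
      define f where "f = (\<lambda>x. enn2real (inflow (\<mu> t) (v t) x) - enn2real (outflow (\<mu> t) (v t) x))"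
      have D: "((\<lambda>s. measure (\<mu> s) {x}) has_real_derivative f x) (at t)" for x
        using elim t unfolding f_def by blast
      \<comment> \<open>The derivative of the atoms is prescribed by the current itself, so the
        given current competes in the minimisation that defines the metric derivative.\<close>
      have "ennreal (beckmann B f) \<le> current_cost (\<mu> t) (v t)"
      proof (rule beckmann_le_current_cost[OF discrete countable \<mu> _ B])
        show "f x = 0" if "x \<notin> B" for x
          using atom_derivative_constraints(1)[OF discrete countable \<mu> t D, of x] B0[OF _ that] t by simp
      qed (use elim t B0 in \<open>auto simp: f_def\<close>)
      then show "\<exists>m. has_metric_derivative \<mu> m {0..1} t \<and> ennreal m \<le> current_cost (\<mu> t) (v t)"
        using D by (intro exI[of _ "beckmann B f"] conjI md[OF t] allI)
    qed
  qed
  then show "AE t\<in>{0..1} in lebesgue. \<exists>m. has_metric_derivative \<mu> m {0..1} t \<and> ennreal m \<le> current_cost (\<mu> t) (v t)"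
    by (rule AE_closed)
qed

end
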